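(* For every $n\ge 3$, every connected $n$-vertex non-homotopic $2^+$-real face graph has at most $4n-8$ edges.
   Context: Graphs are finite and have no loops, but may have parallel edges. A drawing on the sphere $\mathbb{S}^2$ maps vertices to pairwise distinct points and each edge to a simple Jordan arc joining its endpoints, such that no edge passes through a vertex, any two edges have finitely many common points, every common interior point of two edges is a proper crossing, and no three edges pass through the same crossing. Cells are the connected components of $\mathbb{S}^2$ minus the drawing; a vertex-incidence of a cell is an appearance of a vertex on its boundary (counted with repetitions). A drawing is $k^+$-real face if every cell has at least $k$ vertex-incidences. A lens is a region bounded by a simple closed curve consisting of exactly two contiguous parts, each being (a part of) a single edge; a drawing is non-homotopic if every lens contains a vertex or a crossing in its interior. A non-homotopic $k^+$-real face graph is a graph admitting a drawing that is both non-homotopic and $k^+$-real face. *)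

theory Defs
  imports "HOL-Analysis.Analysis"
begin

type_synonym pt = "real^3"

abbreviation S2 :: "pt set" where
  "S2 \<equiv> sphere (0::pt) 1"

definition multigraph :: "'v set \<Rightarrow> 'e set \<Rightarrow> ('e \<Rightarrow> 'v set) \<Rightarrow> bool" where
  "multigraph V E ends \<longleftrightarrow> finite V \<and> finite E \<and>
     (\<forall>e\<in>E. ends e \<subseteq> V \<and> card (ends e) = 2)"

definition graph_connected :: "'v set \<Rightarrow> 'e set \<Rightarrow> ('e \<Rightarrow> 'v set) \<Rightarrow> bool" where
  "graph_connected V E ends \<longleftrightarrow>
     (\<forall>u\<in>V. \<forall>w\<in>V. (\<lambda>x y. \<exists>e\<in>E. ends e = {x, y})\<^sup>*\<^sup>* u w)"

definition proper_crossing :: "pt set \<Rightarrow> pt set \<Rightarrow> pt \<Rightarrow> bool" where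
  "proper_crossing A B p \<longleftrightarrow>
     (\<exists>U h k. openin (top_of_set S2) U \<and> p \<in> U \<and>
        homeomorphism U (ball (0::real\<times>real) 1) h k \<and> h p = 0 \<and>
        h ` (U \<inter> A) = {z \<in> ball 0 1. snd z = 0} \<and>
        h ` (U \<inter> B) = {z \<in> ball 0 1. fst z = 0})"

definition drawing ::
  "'v set \<Rightarrow> 'e set \<Rightarrow> ('e \<Rightarrow> 'v set) \<Rightarrow> ('v \<Rightarrow> pt) \<Rightarrow> ('e \<Rightarrow> real \<Rightarrow> pt) \<Rightarrow> bool" where
  "drawing V E ends pos \<gamma> \<longleftrightarrow>
     inj_on pos V \<and> pos ` V \<subseteq> S2 \<and>
     (\<forall>e\<in>E. arc (\<gamma> e) \<and> path_image (\<gamma> e) \<subseteq> S2 \<and>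
        {pathstart (\<gamma> e), pathfinish (\<gamma> e)} = pos ` ends e \<and>
        path_image (\<gamma> e) \<inter> pos ` V \<subseteq> pos ` ends e) \<and>
     (\<forall>e\<in>E. \<forall>f\<in>E. e \<noteq> f \<longrightarrow>
        finite (path_image (\<gamma> e) \<inter> path_image (\<gamma> f)) \<and>
        (\<forall>x \<in> path_image (\<gamma> e) \<inter> path_image (\<gamma> f). x \<notin> pos ` V \<longrightarrow>
            proper_crossing (path_image (\<gamma> e)) (path_image (\<gamma> f)) x)) \<and>
     (\<forall>e\<in>E. \<forall>f\<in>E. \<forall>g\<in>E. e \<noteq> f \<and> e \<noteq> g \<and> f \<noteq> g \<longrightarrow>
        path_image (\<gamma> e) \<inter> path_image (\<gamma> f) \<inter> path_image (\<gamma> g) \<subseteq> pos ` V)"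

definition drawing_image ::
  "'v set \<Rightarrow> 'e set \<Rightarrow> ('v \<Rightarrow> pt) \<Rightarrow> ('e \<Rightarrow> real \<Rightarrow> pt) \<Rightarrow> pt set" where
  "drawing_image V E pos \<gamma> = pos ` V \<union> (\<Union>e\<in>E. path_image (\<gamma> e))"

definition cells ::
  "'v set \<Rightarrow> 'e set \<Rightarrow> ('v \<Rightarrow> pt) \<Rightarrow> ('e \<Rightarrow> real \<Rightarrow> pt) \<Rightarrow> pt set set" where
  "cells V E pos \<gamma> = components (S2 - drawing_image V E pos \<gamma>)"

text \<open>Vertex-incidences, counted with repetitions: an appearance of a vertex v
  on the boundary of a cell C is an access of C at v, i.e. a class of paths
  starting at v and otherwise running inside C, two such paths being equivalent
  when they can be joined inside C arbitrarily close to v (the same "corner").\<close>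
definition access_path :: "pt set \<Rightarrow> pt \<Rightarrow> (real \<Rightarrow> pt) \<Rightarrow> bool" where
  "access_path C v g \<longleftrightarrow> path g \<and> pathstart g = v \<and> g ` {0<..1} \<subseteq> C"

definition same_access :: "pt set \<Rightarrow> pt \<Rightarrow> (real \<Rightarrow> pt) \<Rightarrow> (real \<Rightarrow> pt) \<Rightarrow> bool" where
  "same_access C v g h \<longleftrightarrow>
     (\<forall>\<epsilon>>0. \<forall>\<delta>>0. \<exists>s\<in>{0<..min \<delta> 1}. \<exists>t\<in>{0<..min \<delta> 1}. \<exists>p.
        path p \<and> pathstart p = g s \<and> pathfinish p = h t \<and>
        path_image p \<subseteq> C \<inter> ball v \<epsilon>)"

definition at_least_k_incidences ::
  "nat \<Rightarrow> 'v set \<Rightarrow> ('v \<Rightarrow> pt) \<Rightarrow> pt set \<Rightarrow> bool" where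
  "at_least_k_incidences k V pos C \<longleftrightarrow>
     (\<exists>w :: nat \<Rightarrow> 'v. \<exists>g :: nat \<Rightarrow> real \<Rightarrow> pt.
        (\<forall>i<k. w i \<in> V \<and> access_path C (pos (w i)) (g i)) \<and>
        (\<forall>i<k. \<forall>j<k. i \<noteq> j \<longrightarrow> w i = w j \<longrightarrow>
           \<not> same_access C (pos (w i)) (g i) (g j)))"

definition k_real_face_drawing ::
  "nat \<Rightarrow> 'v set \<Rightarrow> 'e set \<Rightarrow> ('v \<Rightarrow> pt) \<Rightarrow> ('e \<Rightarrow> real \<Rightarrow> pt) \<Rightarrow> bool" where
  "k_real_face_drawing k V E pos \<gamma> \<longleftrightarrow>
     (\<forall>C\<in>cells V E pos \<gamma>. at_least_k_incidences k V pos C)"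

definition is_crossing ::
  "'v set \<Rightarrow> 'e set \<Rightarrow> ('v \<Rightarrow> pt) \<Rightarrow> ('e \<Rightarrow> real \<Rightarrow> pt) \<Rightarrow> pt \<Rightarrow> bool" where
  "is_crossing V E pos \<gamma> x \<longleftrightarrow>
     (\<exists>e\<in>E. \<exists>f\<in>E. e \<noteq> f \<and> x \<in> path_image (\<gamma> e) \<and> x \<in> path_image (\<gamma> f) \<and> x \<notin> pos ` V)"

text \<open>Non-homotopic: every lens (a region of the sphere bounded by a simple closed
  curve formed by a sub-arc of an edge e and a sub-arc of an edge f meeting exactly
  in their common endpoints) contains a vertex or a crossing in its interior (L is relatively open in S2, so its interior in S2 is L itself).\<close>
definition non_homotopic_drawing ::
  "'v set \<Rightarrow> 'e set \<Rightarrow> ('v \<Rightarrow> pt) \<Rightarrow> ('e \<Rightarrow> real \<Rightarrow> pt) \<Rightarrow> bool" where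
  "non_homotopic_drawing V E pos \<gamma> \<longleftrightarrow>
     (\<forall>e\<in>E. \<forall>f\<in>E. \<forall>a b c d :: real.
        0 \<le> a \<and> a < b \<and> b \<le> 1 \<and> 0 \<le> c \<and> c < d \<and> d \<le> 1 \<and>
        \<gamma> e a \<noteq> \<gamma> e b \<and> {\<gamma> f c, \<gamma> f d} = {\<gamma> e a, \<gamma> e b} \<and>
        \<gamma> e ` {a..b} \<inter> \<gamma> f ` {c..d} = {\<gamma> e a, \<gamma> e b} \<longrightarrow>
        (\<forall>L \<in> components (S2 - (\<gamma> e ` {a..b} \<union> \<gamma> f ` {c..d})).
           (\<exists>v\<in>V. pos v \<in> L) \<or> (\<exists>x\<in>L. is_crossing V E pos \<gamma> x)))"

definition non_homotopic_k_real_face_graph ::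
  "nat \<Rightarrow> 'v set \<Rightarrow> 'e set \<Rightarrow> ('e \<Rightarrow> 'v set) \<Rightarrow> bool" where
  "non_homotopic_k_real_face_graph k V E ends \<longleftrightarrow>
     (\<exists>pos \<gamma>. drawing V E ends pos \<gamma> \<and> non_homotopic_drawing V E pos \<gamma> \<and>
        k_real_face_drawing k V E pos \<gamma>)"

end

(* Let m be the number of edges, X the number of crossings and F the number of cells. Drawing the
   edges one after the other, so that the drawing stays connected, every new segment between two
   points already drawn splits a cell by the Jordan curve theorem; this gives F >= m + X - n + 2.
   By Janiszewski's theorem at most deg v sectors meet at a vertex v, so there are at most 2m
   vertex incidences, and at most 4 sectors meet at a crossing. Two incidences per cell yield
   F <= m, hence X <= n - 2. A cell whose closure contains no crossing has three vertices in its
   closure: otherwise all edges on its boundary would be parallel, and the cell would be a lens.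
   Hence 3F <= 2m + 4X, so m <= 3n - 6 + X <= 4n - 8. *)
theory Submission
  imports Defs
begin

section \<open>Charts and punctured neighbourhoods on the sphere\<close>

text \<open>Near a vertex the edges are just Jordan arcs, which may leave and re-enter a
  neighbourhood infinitely often, so sectors cannot be read off a local picture. Both counts come
  from one configuration instead: a closed path-connected \<open>K\<close> and an arc with exactly
  its two ends on \<open>K\<close>. A second arc joins these ends inside \<open>K\<close>; the
  resulting Jordan curve meets \<open>K\<close> in that second arc, which is connected, so
  Janiszewski's theorem compares the two. Hence the new arc splits exactly one component, and into
  exactly two: "at least two" bounds the cells from below, "at most two" bounds the sectors from
  above. The lower bound for cells is stated under finiteness, because \<open>card\<close> of an
  infinite set is 0. Finiteness comes from the incidence bound, which holds for every finite family
  of cells. The 3 in the last count is reached in two ways: three vertices in the closure, or two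
  vertex incidences and one incidence with a crossing.\<close>

lemma sphere_chart:
  assumes "p \<in> S2"
  obtains h :: "pt \<Rightarrow> complex" and k where "homeomorphism (S2 - {p}) UNIV h k"
proof -
  have "(S2 - {p}) homeomorphic (UNIV :: complex set)"
    using assms by (intro homeomorphic_punctured_sphere_affine) auto
  then show ?thesis
    using that unfolding homeomorphic_def by blast
qed

lemma openin_S2_Diff: "openin (top_of_set S2) W \<Longrightarrow> openin (top_of_set S2) (W - {p})"
  unfolding openin_open by (metis Int_Diff open_delete)

lemma openin_S2_compl: "closed D \<Longrightarrow> openin (top_of_set S2) (S2 - D)"
  unfolding openin_open by (metis Diff_eq open_Compl)

lemma closed_S2_compl: "openin (top_of_set S2) W \<Longrightarrow> closed (S2 - W)"
proof -
  assume "openin (top_of_set S2) W"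
  then obtain T where "open T" "W = S2 \<inter> T" by (auto simp: openin_open)
  then have "S2 - W = S2 \<inter> - T" by auto
  then show ?thesis using \<open>open T\<close> by (metis closed_Compl closed_Int closed_sphere)
qed

text \<open>The sphere has no isolated points, being connected with more than one point (a basis
  vector and its negative); an open subset inherits this.\<close>

lemma closure_punctured:
  assumes "openin (top_of_set S2) W" "x \<in> W"
  shows "x \<in> closure (W - {x})"
proof -
  have xS: "x \<in> S2" using assms openin_subset by fastforce
  have "connected S2" by (intro connected_sphere) simp
  moreover have "S2 \<noteq> {y}" for y :: pt
  proof
    assume eq: "S2 = {y}"
    obtain b :: pt where "b \<in> Basis" using nonempty_Basis by blast
    then have "b \<in> S2" "-b \<in> S2" "b \<noteq> 0" by auto
    then have "b = - b" using eq by (metis singletonD)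
    then show False using \<open>b \<noteq> 0\<close> by (simp add: eq_neg_iff_add_eq_0 flip: scaleR_2)
  qed
  ultimately have lim: "x islimpt S2"
    using connected_imp_perfect xS by blast
  obtain T where T: "open T" "W = S2 \<inter> T" using assms(1) by (auto simp: openin_open)
  have "x islimpt S2 \<inter> T" 
    by (metis (no_types, lifting) IntD2 T assms(2) islimpt_Int_eventually lim eventually_at_in_open')
  then show ?thesis using T by (metis in_closure_iff_infdist_zero islimpt_in_closure)
qed

lemma connected_fill_puncture:
  assumes "openin (top_of_set S2) W" "connected (W - {p})"
  shows "connected W"
proof (cases "p \<in> W")
  case True
  then have "W \<subseteq> closure (W - {p})"
    using closure_punctured[OF assms(1) True] closure_subset[of "W - {p}"] by blast
  then show ?thesis
    by (intro connected_intermediate_closure[OF assms(2)]) (auto simp: in_mono)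
qed (use assms in auto)

text \<open>A chart that sends \<open>v\<close> to infinity turns the closed set
  \<open>S2 - W\<close> into a bounded set of the plane. A closed ball around it pulls back to
  \<open>K\<close>, and the exterior of the ball together with \<open>v\<close> is an open disc
  around \<open>v\<close> inside \<open>W\<close>. The description by \<open>K\<close> is the useful
  one: \<open>K\<close> is a path-connected set on which arcs can end.\<close>

lemma disc_nbhd:
  assumes "openin (top_of_set S2) W" "v \<in> W"
  obtains K where "compact K" "K \<subseteq> S2" "path_connected K" "K \<noteq> {}" "v \<notin> K" "S2 - W \<subseteq> K"
    "connected (S2 - K)" "connected (S2 - K - {v})"
proof -
  have vS: "v \<in> S2" using assms openin_subset by fastforce
  obtain h :: "pt \<Rightarrow> complex" and k where hk: "homeomorphism (S2 - {v}) UNIV h k"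
    using sphere_chart[OF vS] .
  have "compact (S2 - W)" using closed_S2_compl[OF assms(1)]
    by (metis Diff_subset bounded_sphere bounded_subset compact_eq_bounded_closed)
  moreover have "S2 - W \<subseteq> S2 - {v}" using assms by auto
  ultimately have "compact (h ` (S2 - W))"
    using hk by (meson compact_continuous_image continuous_on_subset homeomorphism_def)
  then obtain r where r: "h ` (S2 - W) \<subseteq> cball 0 r"
    by (metis bounded_iff compact_imp_bounded mem_cball_0 subsetI)
  \<comment> \<open>If \<open>S2 - W\<close> is empty, \<open>r\<close> may be negative; the maximum
    keeps the ball, and hence \<open>K\<close>, nonempty.\<close>
  define r' where "r' = max r 1"
  have r': "h ` (S2 - W) \<subseteq> cball 0 r'" using r unfolding r'_def by force
  define K where "K = k ` cball 0 r'"
  have ck: "continuous_on UNIV k" and kim: "k ` UNIV = S2 - {v}" and kh: "\<And>x. x \<in> S2 - {v} \<Longrightarrow> k (h x) = x"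
    and hkk: "\<And>y. h (k y) = y"
    using hk by (auto simp: homeomorphism_def)
  have inj: "inj k" by (metis hkk injI)
  have "compact K" unfolding K_def 
    by (meson ck compact_cball compact_continuous_image continuous_on_subset top_greatest)
  moreover have "path_connected K" unfolding K_def
    by (meson ck convex_cball convex_imp_path_connected path_connected_continuous_image continuous_on_subset top_greatest)
  moreover have "K \<noteq> {}" by (simp add: K_def r'_def) 
  moreover have "K \<subseteq> S2 - {v}" using kim K_def by auto
  moreover have "S2 - W \<subseteq> K"
  proof
    fix x assume "x \<in> S2 - W"
    then have "x \<in> S2 - {v}" "h x \<in> h ` (S2 - W)" using assms by auto
    then have "k (h x) = x" "h x \<in> cball 0 r'" using kh r' by blast+
    then show "x \<in> K" unfolding K_def by (metis imageI)
  qed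
  moreover have eq: "S2 - K - {v} = k ` (- cball 0 r')"
    unfolding K_def Compl_eq_Diff_UNIV using inj kim by (metis Diff_insert Diff_insert2 image_set_diff)
  moreover have "connected (k ` (- cball 0 r'))"
    by (intro connected_continuous_image continuous_on_subset[OF ck] connected_complement_bounded_convex) auto
  ultimately show ?thesis using that[of K] connected_fill_puncture[of "S2 - K" v] openin_S2_compl[of K]
    by (simp add: compact_imp_closed subset_Diff_insert)
qed

text \<open>A small punctured disc around \<open>p\<close> is connected, so it lies in one part of
  any separation of \<open>W - {p}\<close>. Returning \<open>p\<close> to that part would separate
  \<open>W\<close>.\<close>

lemma connected_puncture:
  assumes W: "openin (top_of_set S2) W" "connected W"
  shows "connected (W - {p})"
proof (cases "p \<in> W")
  case True
  obtain K where K: "compact K" "K \<subseteq> S2" "path_connected K" "K \<noteq> {}" "p \<notin> K" "S2 - W \<subseteq> K"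
    "connected (S2 - K)" "connected (S2 - K - {p})"
    using disc_nbhd[OF W(1) True] .
  define U where "U = S2 - K"
  have pS: "p \<in> S2" using True W openin_subset by fastforce
  have U: "openin (top_of_set S2) U" "p \<in> U" "U \<subseteq> W" "connected (U - {p})"
    using K pS openin_S2_compl[of K] by (auto simp: U_def compact_imp_closed)
  have Wp: "openin (top_of_set S2) (W - {p})" using W(1) openin_S2_Diff by blast
  have *: False if E: "openin (top_of_set (W - {p})) E1" "openin (top_of_set (W - {p})) E2" 
    "W - {p} \<subseteq> E1 \<union> E2" "E1 \<inter> E2 = {}" "E2 \<noteq> {}" "U - {p} \<subseteq> E1" for E1 E2
  proof -
    have o: "openin (top_of_set S2) E1" "openin (top_of_set S2) E2"
      using E(1,2) Wp openin_trans by blast+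
    have s: "E1 \<subseteq> W - {p}" "E2 \<subseteq> W - {p}"
      using E(1,2) openin_imp_subset by blast+
    have "openin (top_of_set S2) (E1 \<union> U)" using o U by blast
    moreover have "E1 \<union> U \<subseteq> W" "E2 \<subseteq> W" "W \<subseteq> (E1 \<union> U) \<union> E2" "(E1 \<union> U) \<inter> E2 = {}" "E1 \<union> U \<noteq> {}"
      using s U E by auto
    ultimately show False using W(2) o E(5) W(1) unfolding connected_openin
      by (meson openin_subset_trans openin_imp_subset)
  qed
  show ?thesis unfolding connected_openin
  proof (intro notI, elim exE conjE)
    fix E1 E2 assume E: "openin (top_of_set (W - {p})) E1" "openin (top_of_set (W - {p})) E2" 
    "W - {p} \<subseteq> E1 \<union> E2" "E1 \<inter> E2 = {}" "E1 \<noteq> {}" "E2 \<noteq> {}"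
    have "connected (U - {p})" "U - {p} \<subseteq> W - {p}" using U by auto
    then have "U - {p} \<subseteq> E1 \<or> U - {p} \<subseteq> E2"
    proof -
      obtain T1 T2 where T: "open T1" "open T2" "E1 = (W - {p}) \<inter> T1" "E2 = (W - {p}) \<inter> T2"
        using E(1,2) unfolding openin_open by blast
      have "U - {p} \<subseteq> T1 \<union> T2" "T1 \<inter> T2 \<inter> (U - {p}) = {}" using T E U(3) by blast+
      then have "T1 \<inter> (U - {p}) = {} \<or> T2 \<inter> (U - {p}) = {}"
        using connectedD[OF U(4) T(1,2)] by blast
      then show ?thesis using T E U(3) by blast
    qed
    then show False using *[of E1 E2] *[of E2 E1] E U(3) by blast
  qed
qed (use assms in auto)

section \<open>Janiszewski and Jordan on the sphere\<close>

declare mem_sphere [simp del] mem_sphere_0 [simp del]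

lemma components_two:
  assumes "connected A" "connected B" "A \<noteq> {}" "B \<noteq> {}" "openin (top_of_set X) A" "openin (top_of_set X) B"
    "A \<inter> B = {}" "X = A \<union> B"
  shows "components X = {A, B}"
proof -
  have *: "A \<in> components X"
    if AB: "connected A" "A \<noteq> {}" "openin (top_of_set X) A" "openin (top_of_set X) B" "A \<inter> B = {}" "X = A \<union> B" for A B
  proof -
    obtain C where C: "C \<in> components X" "A \<subseteq> C" 
      using exists_component_superset[of A X] AB by blast
    obtain T1 T2 where T: "open T1" "open T2" "A = X \<inter> T1" "B = X \<inter> T2"
      using AB unfolding openin_open by blast
    have "connected C" "C \<subseteq> X" using C in_components_connected in_components_subset by blast+
    moreover have "C \<subseteq> T1 \<union> T2" "T1 \<inter> T2 \<inter> C = {}" using T AB \<open>C \<subseteq> X\<close> by blast+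
    ultimately have "T1 \<inter> C = {} \<or> T2 \<inter> C = {}" using connectedD T by blast
    then have "C = A" using T AB C \<open>C \<subseteq> X\<close> by blast
    then show ?thesis using C by simp
  qed
  have "A \<in> components X" "B \<in> components X" 
    using *[OF assms(1,3,5,6,7,8)] *[OF assms(2,4,6,5)] assms(7,8) by (metis Int_commute Un_commute)+
  moreover have "C = A \<or> C = B" if C: "C \<in> components X" for C
  proof -
    have "C \<inter> A \<noteq> {} \<or> C \<inter> B \<noteq> {}" 
      using C in_components_nonempty in_components_subset assms(8) by blast
    then show ?thesis using C calculation components_eq by blast
  qed
  ultimately show ?thesis by blast
qed

abbreviation cc :: "pt set \<Rightarrow> pt \<Rightarrow> pt \<Rightarrow> bool" where
  "cc D \<equiv> connected_component (S2 - D)"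

lemma openin_component_S2:
  assumes "openin (top_of_set S2) W" "C \<in> components W"
  shows "openin (top_of_set S2) C"
  using assms locally_path_connected_sphere locally_connected_open_component
    locally_path_connected_imp_locally_connected by blast

text \<open>An arbitrary connected witness may fall apart when the pole of a chart is removed. An
  open one does not, by \<open>connected_puncture\<close>.\<close>

lemma cc_imp_open_connected:
  assumes "openin (top_of_set S2) W" "connected_component W a b"
  obtains C where "openin (top_of_set S2) C" "connected C" "a \<in> C" "b \<in> C" "C \<subseteq> W"
proof
  show "openin (top_of_set S2) (connected_component_set W a)"
    using assms openin_component_S2 componentsI connected_component_in by metis
qed (use assms connected_component_in connected_component_subset in \<open>auto simp: connected_component_refl\<close>)

lemma chart_compact:
  assumes "homeomorphism (S2 - {p}) UNIV h k" "closed S" "S \<subseteq> S2" "p \<notin> S"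
  shows "compact (h ` S)"
proof -
  have "compact S" using assms by (metis bounded_sphere bounded_subset compact_eq_bounded_closed)
  moreover have "continuous_on S h"
    by (rule continuous_on_subset[OF homeomorphism_cont1[OF assms(1)]]) (use assms in auto)
  ultimately show ?thesis using compact_continuous_image by blast
qed

text \<open>This transfers separation theorems between plane and sphere. A connection on the sphere
  may run through the pole \<open>p\<close>; replaced by an open connected set, it survives the
  removal of \<open>p\<close>.\<close>

lemma chart_cc:
  assumes hk: "homeomorphism (S2 - {p}) (UNIV :: complex set) h k" and S: "closed S" "S \<subseteq> S2" "p \<notin> S"
    and ab: "a \<noteq> p" "b \<noteq> p"
  shows "cc S a b \<longleftrightarrow> a \<in> S2 \<and> b \<in> S2 \<and> connected_component (- h ` S) (h a) (h b)"
proof -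
  have ck: "continuous_on UNIV k" and ch: "continuous_on (S2 - {p}) h" and kim: "k ` UNIV = S2 - {p}" 
    and kh: "\<And>x. x \<in> S2 - {p} \<Longrightarrow> k (h x) = x" and hkk: "\<And>y. h (k y) = y"
    using hk by (auto simp: homeomorphism_def)
  show ?thesis
  proof (intro iffI conjI)
    assume L: "cc S a b"
    then show "a \<in> S2" "b \<in> S2" using connected_component_in by blast+
    obtain C where C: "openin (top_of_set S2) C" "connected C" "a \<in> C" "b \<in> C" "C \<subseteq> S2 - S"
      using cc_imp_open_connected[OF openin_S2_compl[OF S(1)] L] .
    have "connected (C - {p})" using connected_puncture C by blast
    then have "connected (h ` (C - {p}))"
      using C by (intro connected_continuous_image continuous_on_subset[OF ch]) auto
    moreover have "h ` (C - {p}) \<subseteq> - h ` S"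
    proof clarify
      fix x y assume xy: "x \<in> C" "x \<noteq> p" "y \<in> S" "h x = h y"
      then have "x \<in> S2 - {p}" "y \<in> S2 - {p}" "x \<noteq> y" using C S by auto
      then show False using kh xy by metis
    qed
    moreover have "h a \<in> h ` (C - {p})" "h b \<in> h ` (C - {p})" using C ab by auto
    ultimately show "connected_component (- h ` S) (h a) (h b)"
      unfolding connected_component_def by blast
  next
    assume "a \<in> S2 \<and> b \<in> S2 \<and> connected_component (- h ` S) (h a) (h b)"
    then have abS: "a \<in> S2 - {p}" "b \<in> S2 - {p}" and "connected_component (- h ` S) (h a) (h b)" using ab by auto
    then obtain T where T: "connected T" "T \<subseteq> - h ` S" "h a \<in> T" "h b \<in> T"
      unfolding connected_component_def by blast
    have "connected (k ` T)"
      using T(1) by (intro connected_continuous_image continuous_on_subset[OF ck]) auto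
    moreover have "k y \<in> S2 - S" if "y \<in> T" for y
    proof -
      have "k y \<notin> S" using T(2) hkk[of y] that by (metis ComplD imageI subsetD)
      moreover have "k y \<in> S2" using kim by blast
      ultimately show ?thesis by simp
    qed
    then have "k ` T \<subseteq> S2 - S" by blast
    moreover have "a \<in> k ` T" "b \<in> k ` T" using T(3,4) kh abS by (metis imageI)+
    ultimately show "cc S a b" unfolding connected_component_def by blast
  qed
qed

lemma Janiszewski_S2:
  assumes S: "closed S" "S \<subseteq> S2" and T: "closed T" "T \<subseteq> S2" and con: "connected (S \<inter> T)"
    and ab: "cc S a b" "cc T a b"
  shows "cc (S \<union> T) a b"
proof (cases "a = b")
  case True
  then show ?thesis using ab connected_component_in by fastforce
next
  case False
  \<comment> \<open>A pole off both sets and different from \<open>a\<close> and \<open>b\<close> is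
    needed. The open set \<open>W\<close> contains \<open>a\<close> and has no isolated points, so
    something is left of it once \<open>a\<close> and \<open>b\<close> are removed.\<close>
  define W where "W = S2 - (S \<union> T)"
  have "openin (top_of_set S2) (W - {b})" using S T unfolding W_def
    by (intro openin_S2_Diff openin_S2_compl closed_Un)
  moreover have "a \<in> W - {b}" using ab[THEN connected_component_in] False W_def by simp
  ultimately have "a \<in> closure (W - {b} - {a})" using closure_punctured by blast
  then have "W - {b} - {a} \<noteq> {}" by (metis closure_empty empty_iff)
  then obtain p where "p \<in> W - {b} - {a}" by blast
  then have p: "p \<in> S2" "p \<notin> S" "p \<notin> T" "p \<noteq> a" "p \<noteq> b" by (auto simp: W_def)
  obtain h :: "pt \<Rightarrow> complex" and k where hk: "homeomorphism (S2 - {p}) UNIV h k"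
    using sphere_chart[OF p(1)] .
  have cS: "compact (h ` S)" "compact (h ` T)" using chart_compact[OF hk] S T p by simp_all
  have "inj_on h (S2 - {p})"
    by (rule inj_on_inverseI[of _ k]) (rule homeomorphism_apply1[OF hk])
  then have "h ` (S \<inter> T) = h ` S \<inter> h ` T"
    using S T p by (intro inj_on_image_Int[of h "S2 - {p}"]) auto
  moreover have "connected (h ` (S \<inter> T))"
    using con hk S p by (intro connected_continuous_image) (auto simp: homeomorphism_def elim!: continuous_on_subset)
  ultimately have con': "connected (h ` S \<inter> h ` T)" by simp
  have "connected_component (- h ` S) (h a) (h b)" "connected_component (- h ` T) (h a) (h b)" "a \<in> S2" "b \<in> S2"
    using chart_cc[OF hk S p(2) p(4,5)[symmetric]] chart_cc[OF hk T p(3) p(4,5)[symmetric]] ab by blast+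
  then have "connected_component (- (h ` S \<union> h ` T)) (h a) (h b)" 
    using Janiszewski[OF cS(1) _ con'] cS(2) compact_imp_closed by blast
  moreover have "closed (S \<union> T)" "S \<union> T \<subseteq> S2" "p \<notin> S \<union> T" using S T p by auto
  ultimately show ?thesis
    using chart_cc[OF hk, of "S \<union> T" a b] p(4,5) \<open>a \<in> S2\<close> \<open>b \<in> S2\<close> by (metis image_Un)
qed

text \<open>An open connected piece of the arc would correspond under the inverse of
  \<open>c\<close> to a connected set of reals with at least three points. The middle one separates
  it, whereas no point separates an open connected subset of the sphere.\<close>

lemma arc_empty_interior_S2:
  assumes c: "arc c" and W: "openin (top_of_set S2) W" "W \<noteq> {}"
  shows "\<not> W \<subseteq> path_image c"
proof
  assume sub: "W \<subseteq> path_image c"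
  obtain v where v: "v \<in> W" using W by auto
  obtain K where K: "compact K" "K \<subseteq> S2" "v \<notin> K" "S2 - W \<subseteq> K" "connected (S2 - K)"
    using disc_nbhd[OF W(1) v] by metis
  define U where "U = S2 - K"
  have U: "openin (top_of_set S2) U" "connected U" "v \<in> U" "U \<subseteq> path_image c"
  proof -
    show "openin (top_of_set S2) U" using K unfolding U_def by (intro openin_S2_compl compact_imp_closed)
    have "W \<subseteq> S2" using W(1) openin_imp_subset by blast
    then show "v \<in> U" "U \<subseteq> path_image c" using v K sub by (auto simp: U_def)
  qed (use K U_def in simp)
  obtain g where g: "homeomorphism {0..1} (path_image c) c g"
    using homeomorphism_compact[of "{0..1}" c "path_image c"] c
    by (auto simp: arc_def path_def path_image_def)
  have cg: "continuous_on U g" 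
    using continuous_on_subset[OF homeomorphism_cont2[OF g] U(4)] .
  have ig: "inj_on g U"
    by (rule inj_on_inverseI[of _ c]) (use homeomorphism_apply2[OF g] U(4) in blast)
  have co: "connected (g ` (U - {x}))" for x
    using connected_puncture[OF U(1,2)] cg by (meson Diff_subset connected_continuous_image continuous_on_subset)
  \<comment> \<open>This supplies three different points of \<open>U\<close>: without isolated
    points, an open set is not exhausted by finitely many removals.\<close>
  have "\<exists>y. y \<in> U - A" if "finite A" for A
    using that
  proof (induction A)
    case (insert x A)
    obtain T where "open T" "U = S2 \<inter> T" using U(1) by (auto simp: openin_open)
    then have "U - A = S2 \<inter> (T - A)" "open (T - A)"
      using insert(1) by (auto simp: open_Diff finite_imp_closed)
    then have op: "openin (top_of_set S2) (U - A)" by (auto simp: openin_open)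
    show ?case 
    proof (cases "x \<in> U - A")
      case True
      then have "U - A - {x} \<noteq> {}" 
        using closure_punctured[OF op True] by (metis closure_empty empty_iff)
      then show ?thesis by blast
    next
      case False
      then show ?thesis using insert.IH by blast
    qed
  qed (use U in auto)
  then obtain x1 x2 x3 where x: "x1 \<in> U" "x2 \<in> U - {x1}" "x3 \<in> U - {x1,x2}"
    by (metis Diff_empty finite.intros)
  have no: False if "x \<in> U" "y \<in> U" "z \<in> U" "g x < g y" "g y < g z" for x y z
  proof -
    have "g x \<in> g ` (U - {y})" "g z \<in> g ` (U - {y})" using that by auto
    then have "g y \<in> g ` (U - {y})" using co[of y] that
      by (meson connected_contains_Icc atLeastAtMost_iff less_imp_le subsetD)
    then show False using ig \<open>y \<in> U\<close> by (auto simp: inj_on_def)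
  qed
  have "g x1 \<noteq> g x2" "g x1 \<noteq> g x3" "g x2 \<noteq> g x3" using x ig by (auto simp: inj_on_def)
  then show False using no x by (metis Diff_iff linorder_neqE_linordered_idom)
qed
text \<open>A pole off the arc exists because the arc has empty interior. The planar theorem then
  joins all points other than the pole, which is itself added as a limit point.\<close>

lemma connected_arc_complement_S2:
  assumes c: "arc c" "path_image c \<subseteq> S2"
  shows "connected (S2 - path_image c)"
proof -
  have cl: "closed (path_image c)" using c by (simp add: closed_arc_image)
  have "openin (top_of_set S2) S2" "S2 \<noteq> {}" by auto
  then have "S2 - path_image c \<noteq> {}" using arc_empty_interior_S2[OF c(1)] by blast
  then obtain p where p: "p \<in> S2" "p \<notin> path_image c" by blast
  obtain h :: "pt \<Rightarrow> complex" and k where hk: "homeomorphism (S2 - {p}) UNIV h k"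
    using sphere_chart[OF p(1)] .
  have sub: "path_image c \<subseteq> S2 - {p}" using c p by blast
  have "inj_on h (path_image c)"
    by (rule inj_on_inverseI[of _ k]) (use homeomorphism_apply1[OF hk] sub in blast)
  moreover have "continuous_on (path_image c) h"
    using continuous_on_subset[OF homeomorphism_cont1[OF hk] sub] .
  ultimately have "arc (h \<circ> c)"
    using c(1) unfolding arc_def by (metis path_continuous_image comp_inj_on path_image_def)
  then have con: "connected (- path_image (h \<circ> c))"
    by (intro connected_arc_complement) simp_all
  have cc: "cc (path_image c) a b" if "a \<in> S2 - path_image c - {p}" "b \<in> S2 - path_image c - {p}" for a b
  proof -
    have "h x \<in> - path_image (h \<circ> c)" if x: "x \<in> S2 - path_image c - {p}" for x
    proof
      assume "h x \<in> path_image (h \<circ> c)"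
      then obtain y where "y \<in> path_image c" "h x = h y" by (auto simp: path_image_compose)
      then have "x = y" using homeomorphism_apply1[OF hk, of x] homeomorphism_apply1[OF hk, of y] x sub by auto
      then show False using x \<open>y \<in> path_image c\<close> by blast
    qed
    then have "connected_component (- path_image (h \<circ> c)) (h a) (h b)"
      using con that connected_iff_connected_component by blast
    then show ?thesis using chart_cc[OF hk cl c(2) p(2), of a b] that by (simp add: path_image_compose)
  qed
  have "connected (S2 - path_image c - {p})"
  proof (cases "S2 - path_image c - {p} = {}")
    case False
    then obtain a where a: "a \<in> S2 - path_image c - {p}" by blast
    have "connected (S2 - path_image c)"
    proof -
      have "p \<in> closure (S2 - path_image c - {p})" 
        using closure_punctured openin_S2_compl[OF cl] p by blast
      moreover have "S2 - path_image c - {p} \<subseteq> connected_component_set (S2 - path_image c) a"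
        using cc[OF a] by blast
      ultimately have "p \<in> closure (connected_component_set (S2 - path_image c) a)" 
        using closure_mono by blast
      then have "connected (insert p (connected_component_set (S2 - path_image c) a))"
        by (intro connected_intermediate_closure[OF connected_connected_component]) (auto simp: closure_subset[THEN subsetD])
      moreover have "insert p (connected_component_set (S2 - path_image c) a) = S2 - path_image c"
        using p connected_component_subset \<open>S2 - path_image c - {p} \<subseteq> _\<close> by fastforce
      ultimately show ?thesis by simp
    qed
    then show ?thesis using connected_puncture openin_S2_compl[OF cl] by blast
  qed (simp only: connected_empty)
  then show ?thesis using connected_fill_puncture openin_S2_compl[OF cl] by blast
qed

text \<open>The planar Jordan curve theorem is carried over by a chart with its pole off the curve.
  That both sides have the whole curve in their closure is recorded because it is what later forces
  a component to split.\<close>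

lemma Jordan_S2:
  assumes c: "arc c1" "arc c2" "path_image c1 \<subseteq> S2" "path_image c2 \<subseteq> S2"
    and ends: "{pathstart c1, pathfinish c1} = {pathstart c2, pathfinish c2}"
    and int: "path_image c1 \<inter> path_image c2 = {pathstart c1, pathfinish c1}"
  obtains A B where "A \<noteq> B" "components (S2 - (path_image c1 \<union> path_image c2)) = {A, B}"
    "path_image c1 \<union> path_image c2 \<subseteq> closure A" "path_image c1 \<union> path_image c2 \<subseteq> closure B"
proof -
  define J where "J = path_image c1 \<union> path_image c2"
  \<comment> \<open>The end points are given only as unordered pairs; \<open>c3\<close> is
    \<open>c2\<close> oriented so that it continues \<open>c1\<close> to a loop.\<close>
  define c3 where "c3 = (if pathstart c2 = pathfinish c1 then c2 else reversepath c2)"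
  have c3: "arc c3" "path_image c3 = path_image c2" using c(2) by (auto simp: c3_def arc_reversepath)
  have c3': "pathstart c3 = pathfinish c1" "pathfinish c3 = pathstart c1"
    using ends unfolding c3_def doubleton_eq_iff by auto
  note c3 = c3 c3'
  have clJ: "closed J" "J \<subseteq> S2" unfolding J_def using c by (auto simp: closed_arc_image)
  have "S2 - J \<noteq> {}"
  proof
    assume "S2 - J = {}"
    then have "S2 - path_image c1 \<subseteq> path_image c2" unfolding J_def by blast
    then have "S2 - path_image c1 = {}"
      using arc_empty_interior_S2[OF c(2) openin_S2_compl] c(1) closed_arc_image by blast
    then have "S2 \<subseteq> path_image c1" by blast
    moreover have "openin (top_of_set S2) S2" "S2 \<noteq> {}" by auto
    ultimately show False using arc_empty_interior_S2[OF c(1)] by blast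
  qed
  then obtain p where p: "p \<in> S2" "p \<notin> J" by blast
  obtain h :: "pt \<Rightarrow> complex" and k where hk: "homeomorphism (S2 - {p}) UNIV h k"
    using sphere_chart[OF p(1)] .
  have ck: "continuous_on UNIV k" and kh: "\<And>x. x \<in> S2 - {p} \<Longrightarrow> k (h x) = x" and hkk: "\<And>y. h (k y) = y"
    and kin: "\<And>y. k y \<in> S2 - {p}"
    using hk by (auto simp: homeomorphism_def)
  have sub: "J \<subseteq> S2 - {p}" using clJ p by blast
  have inj: "inj_on h J"
    by (rule inj_on_inverseI[of _ k]) (use kh sub in blast)
  have conth: "continuous_on J h"
    using continuous_on_subset[OF homeomorphism_cont1[OF hk] sub] .
  define c where "c = c1 +++ c3"
  have "simple_path c" unfolding c_def
    by (rule simple_path_join_loop) (use c c3 int in auto)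
  moreover have cJ: "path_image c = J" unfolding c_def J_def using c3 by (simp add: path_image_join)
  moreover have "pathfinish c = pathstart c" using c3 by (simp add: c_def)
  ultimately have "simple_path (h \<circ> c)" "pathfinish (h \<circ> c) = pathstart (h \<circ> c)"
    using conth inj by (auto simp: simple_path_continuous_image pathfinish_compose pathstart_compose)
  then obtain inner outer where io: "inner \<noteq> {}" "open inner" "connected inner"
      "outer \<noteq> {}" "open outer" "connected outer" "bounded inner" "\<not> bounded outer" "inner \<inter> outer = {}" 
      "inner \<union> outer = - path_image (h \<circ> c)" "frontier inner = path_image (h \<circ> c)" "frontier outer = path_image (h \<circ> c)"
    by (rule Jordan_curve)
  have hJ: "path_image (h \<circ> c) = h ` J" using cJ by (simp add: path_image_compose)
  have JhJ: "J = k ` h ` J" using kh sub by (force simp: image_image)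
  have hk': "homeomorphism UNIV (S2 - {p}) k h" using hk homeomorphism_symD by blast
  have injk: "inj k" by (metis hkk injI)
  have kUN: "k ` UNIV = S2 - {p}" using hk by (simp add: homeomorphism_def)
  define A where "A = k ` inner"
  \<comment> \<open>\<open>B\<close> consists of the image of \<open>outer\<close> and the pole
    \<open>p\<close>, which the chart does not reach.\<close>
  define B where "B = S2 - J - A"
  have opk: "openin (top_of_set S2) (k ` X)" if "open X" for X
  proof -
    have "openin (top_of_set (S2 - {p})) (k ` X)"
      using homeomorphism_imp_open_map[OF hk'] that by auto
    then show ?thesis using openin_trans openin_S2_Diff openin_subtopology_self by blast
  qed
  have opA: "openin (top_of_set S2) A" unfolding A_def using opk io by blast
  have AB: "A \<union> J = k ` closure inner"
    unfolding A_def JhJ[symmetric] using io hJ JhJ closure_Un_frontier[of inner] by (metis image_Un)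
  moreover have "compact (k ` closure inner)"
    using ck io(7) by (intro compact_continuous_image continuous_on_subset[OF ck]) (auto simp: compact_closure)
  ultimately have "closed (J \<union> A)" by (metis compact_imp_closed sup_commute)
  moreover have "B = S2 - (J \<union> A)" unfolding B_def by blast
  ultimately have opB: "openin (top_of_set S2) B" 
    using openin_S2_compl by simp
  have Bp: "B - {p} = k ` outer"
  proof -
    have "outer = UNIV - (h ` J \<union> inner)" using io(9,10) hJ by auto
    then have "k ` outer = k ` UNIV - (k ` h ` J \<union> k ` inner)"
      using injk by (metis image_Un image_set_diff)
    then show ?thesis unfolding B_def A_def kUN JhJ[symmetric] by blast
  qed
  have "connected (k ` outer)" "connected A" unfolding A_def
    using io by (auto intro!: connected_continuous_image continuous_on_subset[OF ck])
  then have conB: "connected B" using connected_fill_puncture[OF opB, of p] Bp by simp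
  have AJ: "A \<inter> J = {}" 
  proof -
    have "inner \<inter> h ` J = {}" using io(10) hJ by auto
    then have "k ` inner \<inter> k ` h ` J = {}" using injk by (metis image_Int image_empty)
    then show ?thesis unfolding A_def using JhJ by simp
  qed
  have "A \<subseteq> S2" unfolding A_def using kin by blast
  have closk: "k ` closure X \<subseteq> closure (k ` X)" for X
    by (rule image_closure_subset[OF continuous_on_subset[OF ck]]) (auto simp: closure_subset)
  have JA: "J \<subseteq> closure A" using closk[of inner] AB unfolding A_def by blast
  have "h ` J \<subseteq> closure outer" using io hJ by (metis closure_Un_frontier Un_upper2)
  then have "J \<subseteq> closure (k ` outer)" using closk[of outer] JhJ by blast
  then have JB: "J \<subseteq> closure B" using Bp by (metis Diff_subset closure_mono order_trans)
  have ne: "A \<noteq> {}" "B \<noteq> {}" using io Bp by (auto simp: A_def)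
  have "components (S2 - J) = {A, B}"
  proof (rule components_two)
    show "openin (top_of_set (S2 - J)) A" "openin (top_of_set (S2 - J)) B"
      using opA opB AJ \<open>A \<subseteq> S2\<close> by (auto simp: B_def intro!: openin_subset_trans[of S2 _ "S2 - J"])
  qed (use \<open>connected A\<close> conB ne AJ \<open>A \<subseteq> S2\<close> in \<open>auto simp: B_def\<close>)
  moreover have "A \<noteq> B" using ne by (auto simp: B_def)
  ultimately show ?thesis using that JA JB unfolding J_def by blast
qed

section \<open>Adding an arc to a connected set\<close>

text \<open>The second arc \<open>b\<close> runs inside \<open>K\<close> between the ends of
  \<open>c\<close>, and \<open>J\<close> is the Jordan curve formed by the two. Thus
  \<open>K \<inter> J\<close> is \<open>b\<close>, which is connected, and adding \<open>J\<close>
  to \<open>K\<close> is the same as adding \<open>c\<close>. \<open>C0\<close> is the only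
  component of the complement of \<open>K\<close> that \<open>c\<close> enters.\<close>

lemma add_arc_setup:
  assumes K: "closed K" "K \<subseteq> S2" "path_connected K"
    and c: "arc c" "path_image c \<subseteq> S2" "path_image c \<inter> K = {pathstart c, pathfinish c}"
  obtains C0 J A B where "C0 \<in> components (S2 - K)" "path_image c - K \<subseteq> C0" "path_image c - K \<noteq> {}"
    "closed J" "J \<subseteq> S2" "connected (K \<inter> J)" "K \<union> J = K \<union> path_image c" "path_image c \<subseteq> J"
    "A \<noteq> B" "components (S2 - J) = {A, B}" "J \<subseteq> closure A" "J \<subseteq> closure B"
proof -
  have eq: "path_image c - K = path_image c - {pathstart c, pathfinish c}" using c(3) by blast
  have con: "connected (path_image c - K)" "path_image c - K \<noteq> {}" 
    unfolding eq using c(1) arc_imp_simple_path connected_simple_path_endless nonempty_simple_path_endless by blast+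
  obtain C0 where C0: "C0 \<in> components (S2 - K)" "path_image c - K \<subseteq> C0"
    using exists_component_superset[of "path_image c - K" "S2 - K"] con c(2) by blast
  have "pathstart c \<in> K" "pathfinish c \<in> K" "pathstart c \<noteq> pathfinish c"
    using c(3) arc_distinct_ends[OF c(1)] by auto
  then obtain b where b: "arc b" "path_image b \<subseteq> K" "pathstart b = pathstart c" "pathfinish b = pathfinish c"
    using K(3) unfolding path_connected_arcwise by meson
  have bc: "path_image c \<inter> path_image b = {pathstart c, pathfinish c}"
    using b c(3) pathstart_in_path_image[of b] pathfinish_in_path_image[of b] by auto
  define J where "J = path_image c \<union> path_image b"
  obtain A B where AB: "A \<noteq> B" "components (S2 - J) = {A, B}" "J \<subseteq> closure A" "J \<subseteq> closure B"
  proof (rule Jordan_S2[OF c(1) b(1) c(2) _ _ bc])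
    show "path_image b \<subseteq> S2" using b K by blast
    show "{pathstart c, pathfinish c} = {pathstart b, pathfinish b}" using b by simp
  qed (simp only: J_def[symmetric])
  have "K \<inter> J = path_image b" unfolding J_def using b bc c(3) by blast
  then have "connected (K \<inter> J)" using b(1) connected_arc_image by simp
  moreover have "closed J" "J \<subseteq> S2" "K \<union> J = K \<union> path_image c" "path_image c \<subseteq> J"
    unfolding J_def using b c K by (auto simp: closed_arc_image)
  ultimately show ?thesis using that C0 con AB by blast
qed

lemma component_eq_if_cc:
  assumes "Z \<in> components (S2 - D)" "Z' \<in> components (S2 - D)" "a \<in> Z" "b \<in> Z'" "cc D a b"
  shows "Z = Z'"
proof -
  obtain T where T: "connected T" "a \<in> T" "b \<in> T" "T \<subseteq> S2 - D"
    using assms(5) unfolding connected_component_def by blast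
  then have "T \<subseteq> Z" "T \<subseteq> Z'" using components_maximal assms(1-4) by (metis disjoint_iff)+
  then show ?thesis using components_eq assms T by blast
qed

lemma cc_if_component:
  assumes "Z \<in> components (S2 - D)" "a \<in> Z" "b \<in> Z"
  shows "cc D a b"
  using assms in_components_connected in_components_subset unfolding connected_component_def by blast

text \<open>Components other than \<open>C0\<close> are not touched. Two pieces of \<open>C0\<close>
  on the same side of \<open>J\<close> are joined off \<open>K\<close> and off \<open>J\<close>,
  hence off both by Janiszewski's theorem; so each side contributes at most one piece.\<close>

lemma add_arc_upper:
  assumes K: "closed K" "K \<subseteq> S2" "path_connected K"
    and c: "arc c" "path_image c \<subseteq> S2" "path_image c \<inter> K = {pathstart c, pathfinish c}"
    and fin: "finite (components (S2 - K))"
  shows "finite (components (S2 - (K \<union> path_image c))) \<and>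
    card (components (S2 - (K \<union> path_image c))) \<le> card (components (S2 - K)) + 1"
proof -
  obtain C0 J A B where C0: "C0 \<in> components (S2 - K)" "path_image c - K \<subseteq> C0" 
    and J: "closed J" "J \<subseteq> S2" "connected (K \<inter> J)" "K \<union> J = K \<union> path_image c"
    and AB: "A \<noteq> B" "components (S2 - J) = {A, B}"
    using add_arc_setup[OF K c] by metis
  define \<X> where "\<X> = components (S2 - (K \<union> path_image c))"
  define \<Z> where "\<Z> = {Z \<in> \<X>. Z \<subseteq> C0}"
  have 1: "Z \<in> (components (S2 - K) - {C0}) \<union> \<Z>" if Z: "Z \<in> \<X>" for Z
  proof -
    have Zp: "connected Z" "Z \<noteq> {}" "Z \<subseteq> S2 - (K \<union> path_image c)"
      using Z in_components_connected in_components_nonempty in_components_subset unfolding \<X>_def by blast+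
    then obtain C where C: "C \<in> components (S2 - K)" "Z \<subseteq> C"
      using exists_component_superset[of Z "S2 - K"] by blast
    show ?thesis
    proof (cases "C = C0")
      case False
      then have "C \<inter> C0 = {}" using components_eq C C0 by blast
      then have "C \<subseteq> S2 - (K \<union> path_image c)" using C0(2) in_components_subset[OF C(1)] by blast
      then have "C \<subseteq> Z" using components_maximal[of Z] Z in_components_connected[OF C(1)] Zp C(2) unfolding \<X>_def by blast
      then have "Z = C" using C(2) by simp
      then show ?thesis using C(1) False by simp
    qed (use C Z \<Z>_def in blast)
  qed
  have side: "Z \<subseteq> A \<or> Z \<subseteq> B" if "Z \<in> \<X>" for Z
  proof -
    have "connected Z" "Z \<noteq> {}" "Z \<subseteq> S2 - J"
      using that in_components_connected in_components_nonempty in_components_subset[of Z] J(4) unfolding \<X>_def by blast+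
    then show ?thesis using exists_component_superset[of Z "S2 - J"] AB by auto
  qed
  have same: "Z = Z'" if Z: "Z \<in> \<Z>" "Z' \<in> \<Z>" and D: "D \<in> {A, B}" "Z \<subseteq> D" "Z' \<subseteq> D" for Z Z' D
  proof -
    obtain a b where ab: "a \<in> Z" "b \<in> Z'" using Z in_components_nonempty unfolding \<Z>_def \<X>_def by blast
    have "cc K a b" using cc_if_component[OF C0(1)] ab Z unfolding \<Z>_def by blast
    moreover have "cc J a b" using cc_if_component[of D J] ab D AB by blast
    ultimately have "cc (K \<union> J) a b" by (rule Janiszewski_S2[OF K(1,2) J(1-3)])
    then show ?thesis using component_eq_if_cc[of Z "K \<union> J" Z' a b] Z ab J(4) unfolding \<Z>_def \<X>_def by simp
  qed
  \<comment> \<open>The side of a piece is a truth value that determines the piece, whence the bound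
    2.\<close>
  have "inj_on (\<lambda>Z. Z \<subseteq> A) \<Z>"
  proof (rule inj_onI)
    fix Z Z' assume Z: "Z \<in> \<Z>" "Z' \<in> \<Z>" "(Z \<subseteq> A) = (Z' \<subseteq> A)"
    then show "Z = Z'" using same[OF Z(1,2), of A] same[OF Z(1,2), of B] side[of Z] side[of Z'] \<Z>_def by blast
  qed
  then have \<Z>: "finite \<Z>" "card \<Z> \<le> 2" 
    using inj_on_finite[of "\<lambda>Z. Z \<subseteq> A" \<Z> UNIV] card_inj_on_le[of "\<lambda>Z. Z \<subseteq> A" \<Z> UNIV] by (auto simp: card_UNIV_bool)
  have sub: "\<X> \<subseteq> (components (S2 - K) - {C0}) \<union> \<Z>" using 1 by blast
  then have "finite \<X>" using fin \<Z>(1) finite_subset by blast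
  moreover have "card \<X> \<le> card (components (S2 - K)) + 1"
  proof -
    have "card \<X> \<le> card (components (S2 - K) - {C0}) + card \<Z>"
      using card_mono[OF _ sub] card_Un_le fin \<Z>(1) by (meson finite_Diff finite_Un order_trans)
    then show ?thesis using \<Z>(2) C0(1) fin card_Diff_singleton[of C0] card_gt_0_iff[of "components (S2 - K)"] by fastforce
  qed
  ultimately show ?thesis unfolding \<X>_def by blast
qed

text \<open>An arc has empty interior and cannot swallow an open component, so every old component
  keeps a piece. Pieces of different components are different.\<close>

lemma component_choice:
  assumes K: "closed K" "K \<subseteq> S2" and c: "arc c"
  obtains g where "\<And>C. C \<in> components (S2 - K) \<Longrightarrow> g C \<in> components (S2 - (K \<union> path_image c)) \<and> g C \<subseteq> C"
    "inj_on g (components (S2 - K))"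
proof -
  have "\<exists>Z. Z \<in> components (S2 - (K \<union> path_image c)) \<and> Z \<subseteq> C" if C: "C \<in> components (S2 - K)" for C
  proof -
    have "\<not> C \<subseteq> path_image c"
      using arc_empty_interior_S2[OF c openin_component_S2[OF openin_S2_compl[OF K(1)] C]] in_components_nonempty[OF C] by blast
    then obtain x where x: "x \<in> C" "x \<notin> path_image c" by blast
    then have "x \<in> S2 - (K \<union> path_image c)" using in_components_subset[OF C] by blast
    then obtain Z where Z: "Z \<in> components (S2 - (K \<union> path_image c))" "x \<in> Z" by (metis UnionE Union_components)
    then have "Z \<subseteq> C" using x C in_components_subset[OF Z(1)] in_components_connected[OF Z(1)]
      by (intro components_maximal[OF C]) auto
    then show ?thesis using Z by blast
  qed
  then obtain g where g: "\<And>C. C \<in> components (S2 - K) \<Longrightarrow> g C \<in> components (S2 - (K \<union> path_image c)) \<and> g C \<subseteq> C"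
    by metis
  moreover have "inj_on g (components (S2 - K))"
  proof (rule inj_onI)
    fix C C' assume C: "C \<in> components (S2 - K)" "C' \<in> components (S2 - K)" "g C = g C'"
    then have "C \<inter> C' \<noteq> {}" using g[OF C(1)] g[OF C(2)] in_components_nonempty by blast
    then show "C = C'" using components_eq C by blast
  qed
  ultimately show ?thesis using that by blast
qed

lemma add_dangling_lower:
  assumes K: "closed K" "K \<subseteq> S2" and c: "arc c"
    and fin: "finite (components (S2 - (K \<union> path_image c)))"
  shows "finite (components (S2 - K)) \<and> card (components (S2 - K)) \<le> card (components (S2 - (K \<union> path_image c)))"
proof -
  obtain g where g: "\<And>C. C \<in> components (S2 - K) \<Longrightarrow> g C \<in> components (S2 - (K \<union> path_image c)) \<and> g C \<subseteq> C"
    "inj_on g (components (S2 - K))" using component_choice[OF K c] by blast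
  then have "g ` components (S2 - K) \<subseteq> components (S2 - (K \<union> path_image c))" by blast
  then show ?thesis using inj_on_finite[OF g(2) _ fin] card_inj_on_le[OF g(2) _ fin] by simp
qed

text \<open>An inner point of \<open>c\<close> lies in the open set \<open>C0\<close> and in the
  closure of both sides of \<open>J\<close>. So \<open>C0\<close> has points on both sides off
  \<open>J\<close>, which gives two pieces, while an injective choice of one piece per old component
  uses only one of them.\<close>

lemma add_arc_lower:
  assumes K: "closed K" "K \<subseteq> S2" "path_connected K"
    and c: "arc c" "path_image c \<subseteq> S2" "path_image c \<inter> K = {pathstart c, pathfinish c}"
    and fin: "finite (components (S2 - (K \<union> path_image c)))"
  shows "finite (components (S2 - K)) \<and> card (components (S2 - K)) + 1 \<le> card (components (S2 - (K \<union> path_image c)))"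
proof -
  obtain C0 J A B where C0: "C0 \<in> components (S2 - K)" "path_image c - K \<subseteq> C0" "path_image c - K \<noteq> {}"
    and J: "K \<union> J = K \<union> path_image c" "path_image c \<subseteq> J"
    and AB: "A \<noteq> B" "components (S2 - J) = {A, B}" "J \<subseteq> closure A" "J \<subseteq> closure B"
    using add_arc_setup[OF K c] by metis
  define \<X> where "\<X> = components (S2 - (K \<union> path_image c))"
  obtain g where g: "\<And>C. C \<in> components (S2 - K) \<Longrightarrow> g C \<in> \<X> \<and> g C \<subseteq> C"
    "inj_on g (components (S2 - K))" using component_choice[OF K(1,2) c(1)] unfolding \<X>_def by blast
  obtain m where m: "m \<in> path_image c" "m \<notin> K" "m \<in> C0" using C0 by blast
  obtain T where T: "open T" "C0 = S2 \<inter> T"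
    using openin_component_S2[OF openin_S2_compl[OF K(1)] C0(1)] by (auto simp: openin_open)
  have *: "\<exists>Z \<in> \<X>. Z \<subseteq> C0 \<and> Z \<subseteq> D" if D: "D \<in> {A, B}" for D
  proof -
    have Dc: "D \<in> components (S2 - J)" using AB D by blast
    have "m \<in> closure D" using D AB(3,4) m(1) J(2) by blast
    then obtain x where x: "x \<in> D" "x \<in> T" using T(1) m(3) T(2) closure_iff_nhds_not_empty by (metis IntD2 disjoint_iff order_refl)
    then have "x \<in> C0" "x \<notin> J" using T in_components_subset[OF Dc] by blast+
    then have "x \<in> S2 - (K \<union> path_image c)" using J in_components_subset[OF C0(1)] by blast
    then obtain Z where Z: "Z \<in> \<X>" "x \<in> Z" unfolding \<X>_def by (metis UnionE Union_components)
    have Zp: "Z \<subseteq> S2 - (K \<union> J)" "connected Z" using Z(1) in_components_subset in_components_connected J(1) unfolding \<X>_def by auto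
    have "Z \<subseteq> C0" using Zp Z \<open>x \<in> C0\<close> by (intro components_maximal[OF C0(1)]) auto
    moreover have "Z \<subseteq> D" using Zp Z x by (intro components_maximal[OF Dc]) auto
    ultimately show ?thesis using Z by blast
  qed
  obtain Z1 Z2 where Z: "Z1 \<in> \<X>" "Z1 \<subseteq> C0" "Z1 \<subseteq> A" "Z2 \<in> \<X>" "Z2 \<subseteq> C0" "Z2 \<subseteq> B"
    using *[of A] *[of B] by auto
  have "A \<inter> B = {}" using AB components_eq[of A "S2 - J" B] by blast
  then have "Z1 \<noteq> Z2" using Z in_components_nonempty unfolding \<X>_def by blast
  then obtain Z' where Z': "Z' \<in> \<X>" "Z' \<subseteq> C0" "Z' \<noteq> g C0" using Z by metis
  have "Z' \<notin> g ` components (S2 - K)"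
  proof
    assume "Z' \<in> g ` components (S2 - K)"
    then obtain C where C: "C \<in> components (S2 - K)" "Z' = g C" by blast
    then have "Z' \<subseteq> C \<inter> C0" using g(1) Z' by blast
    moreover have "Z' \<noteq> {}" using Z'(1) in_components_nonempty unfolding \<X>_def by blast
    ultimately have "C = C0" using components_eq[OF C(1) C0(1)] by blast
    then show False using C Z' by blast
  qed
  moreover have sub: "insert Z' (g ` components (S2 - K)) \<subseteq> \<X>" using g(1) Z' by blast
  moreover have "finite (components (S2 - K))" 
    using sub fin g(2) inj_on_finite[of g "components (S2 - K)" \<X>] unfolding \<X>_def by blast
  ultimately show ?thesis using card_mono[OF _ sub] fin card_image[OF g(2)] unfolding \<X>_def by simp
qed

section \<open>Sectors at a point\<close>

lemma first_hit:
  assumes c: "arc c" and K: "closed K" "pathstart c \<notin> K" "pathfinish c \<in> K"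
  obtains t where "0 < t" "t \<le> 1" "c t \<in> K" "\<And>s. 0 \<le> s \<Longrightarrow> s < t \<Longrightarrow> c s \<notin> K"
proof -
  define T where "T = {s \<in> {0..1}. c s \<in> K}"
  have "T = {0..1} \<inter> c -` K" by (auto simp: T_def)
  then have "closed T" using c K(1) by (auto simp: arc_def path_def intro!: continuous_closed_preimage)
  moreover have "T \<subseteq> {0..1}" by (auto simp: T_def)
  ultimately have "compact T" using compact_Int_closed[OF compact_Icc[of 0 "1::real"]] by (metis inf.absorb_iff2)
  moreover have "1 \<in> T" using K(3) by (simp add: T_def pathfinish_def)
  ultimately obtain t where t: "t \<in> T" "\<And>s. s \<in> T \<Longrightarrow> t \<le> s" using compact_attains_inf by (metis empty_iff)
  have "t \<noteq> 0" using t(1) K(2) by (auto simp: T_def pathstart_def)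
  show ?thesis
  proof
    show "0 < t" "t \<le> 1" "c t \<in> K" using t \<open>t \<noteq> 0\<close> by (auto simp: T_def)
    show "c s \<notin> K" if "0 \<le> s" "s < t" for s using t(2)[of s] that \<open>t \<le> 1\<close> by (auto simp: T_def)
  qed
qed

text \<open>The arcs may leave the disc \<open>S2 - K\<close> and enter it again arbitrarily often, so they are cut at
  their first hits of \<open>K\<close>. The remaining pieces together with \<open>K\<close> meet the star in \<open>K\<close> only, which is
  connected; hence by Janiszewski's theorem they do not separate points close to \<open>x\<close>.\<close>
lemma star_setup:
  assumes I: "finite I"
    and arc: "\<And>i. i \<in> I \<Longrightarrow> arc (\<alpha> i) \<and> pathstart (\<alpha> i) = x \<and> path_image (\<alpha> i) \<subseteq> S2"
    and disj: "\<And>i j. i \<in> I \<Longrightarrow> j \<in> I \<Longrightarrow> i \<noteq> j \<Longrightarrow> path_image (\<alpha> i) \<inter> path_image (\<alpha> j) = {x}"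
    and W: "openin (top_of_set S2) W" "x \<in> W"
    and D: "D \<inter> W \<subseteq> (\<Union>i\<in>I. path_image (\<alpha> i))"
  obtains K \<beta> N where "closed K" "K \<subseteq> S2" "path_connected K" "K \<noteq> {}" "x \<notin> K" "connected (S2 - K)"
    "\<forall>i\<in>I. arc (\<beta> i) \<and> pathstart (\<beta> i) = x \<and> path_image (\<beta> i) \<subseteq> path_image (\<alpha> i)
       \<and> path_image (\<beta> i) \<inter> K = {pathfinish (\<beta> i)}"
    "openin (top_of_set S2) N" "x \<in> N" "N \<subseteq> W - K" "N \<inter> D \<subseteq> (\<Union>i\<in>I. path_image (\<beta> i))"
    "\<forall>a\<in>N - D. \<forall>b\<in>N - D. cc (K \<union> (\<Union>i\<in>I. path_image (\<beta> i))) a b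
      \<longrightarrow> connected_component (W - D) a b"
proof -
  \<comment> \<open>Removing the far ends from the neighbourhood puts them into \<open>K\<close>, so
    that every arc does hit \<open>K\<close>.\<close>
  define W' where "W' = W - pathfinish ` \<alpha> ` I"
  have "pathfinish (\<alpha> i) \<noteq> x" if "i \<in> I" for i using arc_distinct_ends[of "\<alpha> i"] arc[OF that] by auto
  then have "x \<in> W'" using W(2) unfolding W'_def by blast
  moreover obtain T where "open T" "W = S2 \<inter> T" using W(1) by (auto simp: openin_open)
  then have "W' = S2 \<inter> (T - pathfinish ` \<alpha> ` I)" "open (T - pathfinish ` \<alpha> ` I)"
    using I by (auto simp: open_Diff finite_imp_closed W'_def)
  then have "openin (top_of_set S2) W'" by (auto simp: openin_open)
  ultimately obtain K where K: "compact K" "K \<subseteq> S2" "path_connected K" "K \<noteq> {}" "x \<notin> K" "S2 - W' \<subseteq> K"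
    "connected (S2 - K)" using disc_nbhd by metis
  have clK: "closed K" using K(1) compact_imp_closed by blast
  have "\<exists>t. 0 < t \<and> t \<le> 1 \<and> \<alpha> i t \<in> K \<and> (\<forall>s. 0 \<le> s \<longrightarrow> s < t \<longrightarrow> \<alpha> i s \<notin> K)" if i: "i \<in> I" for i
  proof -
    have "pathfinish (\<alpha> i) \<in> S2 - W'" using arc[OF i] i unfolding W'_def by auto
    then have "pathfinish (\<alpha> i) \<in> K" using K by blast
    then show ?thesis using first_hit[of "\<alpha> i" K] arc[OF i] K(5) clK by metis
  qed
  then obtain t where t: "\<And>i. i \<in> I \<Longrightarrow> 0 < t i \<and> t i \<le> 1 \<and> \<alpha> i (t i) \<in> K \<and> (\<forall>s. 0 \<le> s \<longrightarrow> s < t i \<longrightarrow> \<alpha> i s \<notin> K)"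
    by metis
  define \<beta> where "\<beta> i = subpath 0 (t i) (\<alpha> i)" for i
  define \<rho> where "\<rho> i = \<alpha> i ` {t i..1}" for i
  have \<beta>im: "path_image (\<beta> i) = \<alpha> i ` {0..t i}" if "i \<in> I" for i
    using t[OF that] by (simp add: \<beta>_def path_image_subpath)
  have \<alpha>im: "path_image (\<alpha> i) = path_image (\<beta> i) \<union> \<rho> i" if "i \<in> I" for i
  proof -
    have "{0..1} = {0..t i} \<union> {t i..1}" using t[OF that] by auto
    then show ?thesis using \<beta>im[OF that] by (simp add: \<rho>_def path_image_def flip: image_Un)
  qed
  have inj: "\<alpha> i s \<noteq> \<alpha> i s'" if "i \<in> I" "s \<in> {0..1}" "s' \<in> {0..1}" "s \<noteq> s'" for i s s'
    using arc[OF that(1)] that by (auto simp: arc_def inj_on_def)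
  have \<alpha>0: "\<alpha> i 0 = x" if "i \<in> I" for i using arc[OF that] by (simp add: pathstart_def)
  have \<beta>: "arc (\<beta> i) \<and> pathstart (\<beta> i) = x \<and> path_image (\<beta> i) \<subseteq> path_image (\<alpha> i)
       \<and> path_image (\<beta> i) \<inter> K = {pathfinish (\<beta> i)}" if i: "i \<in> I" for i
  proof (intro conjI)
    show "arc (\<beta> i)" unfolding \<beta>_def using arc[OF i] t[OF i] by (intro arc_subpath_arc) (auto simp: arc_def dest: inj[OF i])
    show "pathstart (\<beta> i) = x" using \<alpha>0[OF i] by (simp add: \<beta>_def)
    show "path_image (\<beta> i) \<inter> K = {pathfinish (\<beta> i)}"
    proof -
      have "s = t i" if "s \<in> {0..t i}" "\<alpha> i s \<in> K" for s using t[OF i] that by force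
      then show ?thesis using t[OF i] unfolding \<beta>im[OF i] by (auto simp: \<beta>_def)
    qed
  qed (use \<alpha>im[OF i] in blast)
  have x\<rho>: "x \<notin> \<rho> i" if "i \<in> I" for i
  proof
    assume "x \<in> \<rho> i"
    then obtain s where "s \<in> {t i..1}" "x = \<alpha> i s" by (auto simp: \<rho>_def)
    then show False using inj[OF that, of 0 s] \<alpha>0[OF that] t[OF that] by simp
  qed
  have \<rho>cl: "closed (\<rho> i)" if i: "i \<in> I" for i
  proof -
    have "continuous_on {t i..1} (\<alpha> i)" using arc[OF i] t[OF i] 
      by (auto simp: arc_def path_def elim!: continuous_on_subset)
    then show ?thesis unfolding \<rho>_def by (simp add: compact_continuous_image compact_imp_closed)
  qed
  have \<beta>\<rho>: "path_image (\<beta> i) \<inter> \<rho> j \<subseteq> K" if ij: "i \<in> I" "j \<in> I" for i j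
  proof (cases "i = j")
    case True
    have "s = t i" if "s \<in> {0..t i}" "s' \<in> {t i..1}" "\<alpha> i s = \<alpha> i s'" for s s'
      using inj[OF ij(1), of s s'] t[OF ij(1)] that by force
    then show ?thesis using t[OF ij(1)] unfolding \<beta>im[OF ij(1)] \<rho>_def True[symmetric] by blast
  next
    case False
    then show ?thesis using disj[OF ij False] \<alpha>im[OF ij(1)] \<alpha>im[OF ij(2)] x\<rho>[OF ij(2)] by auto
  qed
  define S where "S = K \<union> (\<Union>i\<in>I. path_image (\<beta> i))"
  define R where "R = K \<union> (\<Union>i\<in>I. \<rho> i)"
  have clS: "closed S" unfolding S_def using clK I \<beta> by (auto intro!: closed_UN closed_arc_image)
  have clR: "closed R" unfolding R_def using clK I \<rho>cl by (auto intro!: closed_UN)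
  have sub: "S \<subseteq> S2" "R \<subseteq> S2" unfolding S_def R_def using K(2) \<alpha>im arc by blast+
  have "S \<inter> R = K" unfolding S_def R_def using \<beta>\<rho> by blast
  then have conSR: "connected (S \<inter> R)" using K(3) path_connected_imp_connected by simp
  have xS: "x \<in> S2 - R" using K(5) x\<rho> W openin_imp_subset[OF W(1)] unfolding R_def by blast
  \<comment> \<open>The complement of \<open>K'\<close> is a disc around \<open>x\<close> that
    misses \<open>R\<close>; being connected, it joins any two of its points off \<open>R\<close>,
    which is one of the two hypotheses of Janiszewski's theorem.\<close>
  obtain K' where K': "compact K'" "K' \<subseteq> S2" "x \<notin> K'" "S2 - (S2 - R) \<subseteq> K'" "connected (S2 - K')"
    using disc_nbhd[OF openin_S2_compl[OF clR] xS] by metis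
  define N where "N = S2 - K'"
  have N: "openin (top_of_set S2) N" "x \<in> N" "N \<subseteq> S2 - R"
    unfolding N_def using K' xS by (auto intro!: openin_S2_compl compact_imp_closed)
  have NW: "N \<subseteq> W - K"
  proof -
    have "N \<subseteq> S2 - K" using N(3) unfolding R_def by blast
    then show ?thesis using K(6) unfolding W'_def by blast
  qed
  have ND: "N \<inter> D \<subseteq> (\<Union>i\<in>I. path_image (\<beta> i))"
  proof
    fix y assume y: "y \<in> N \<inter> D"
    then obtain i where "i \<in> I" "y \<in> path_image (\<alpha> i)" using D NW by blast
    then show "y \<in> (\<Union>i\<in>I. path_image (\<beta> i))" using y N(3) \<alpha>im unfolding R_def by blast
  qed
  have fin: "connected_component (W - D) a b" if ab: "a \<in> N - D" "b \<in> N - D" "cc S a b" for a b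
  proof -
    have "cc R a b" unfolding connected_component_def
      using N(3) K'(5) ab unfolding N_def by blast
    then have "cc (S \<union> R) a b" using Janiszewski_S2[OF clS sub(1) clR sub(2) conSR] ab by blast
    then obtain T where T: "connected T" "a \<in> T" "b \<in> T" "T \<subseteq> S2 - (S \<union> R)"
      unfolding connected_component_def by blast
    have "T \<subseteq> W - D"
    proof
      fix y assume "y \<in> T"
      then have y: "y \<in> S2" "y \<notin> S" "y \<notin> R" using T by auto
      then have "y \<notin> K" by (simp add: S_def)
      then have "y \<in> W" using y(1) K(6) unfolding W'_def by blast
      moreover have "y \<notin> (\<Union>i\<in>I. path_image (\<alpha> i))" using y \<alpha>im unfolding S_def R_def by blast
      ultimately show "y \<in> W - D" using D by blast
    qed
    then show ?thesis using T unfolding connected_component_def by blast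
  qed
  show ?thesis
    using fin \<beta> unfolding S_def by (intro that[OF clK K(2,3,4,5,7) _ N(1,2) NW ND]) blast+
qed

text \<open>The first arc meets \<open>K\<close> in a single point and does not separate, by
  Janiszewski's theorem. Every later arc joins \<open>x\<close> to \<open>K\<close>, both already in
  the connected set, and adds at most one component. The free first arc makes the bound
  \<open>card I\<close> rather than \<open>card I + 1\<close>.\<close>

lemma star_components:
  assumes K: "closed K" "K \<subseteq> S2" "path_connected K" "connected (S2 - K)" "x \<notin> K"
    and I: "finite I" "I \<noteq> {}"
    and \<beta>: "\<And>i. i \<in> I \<Longrightarrow> arc (\<beta> i) \<and> pathstart (\<beta> i) = x \<and> path_image (\<beta> i) \<subseteq> S2 \<and> path_image (\<beta> i) \<inter> K = {pathfinish (\<beta> i)}"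
    and disj: "\<And>i j. i \<in> I \<Longrightarrow> j \<in> I \<Longrightarrow> i \<noteq> j \<Longrightarrow> path_image (\<beta> i) \<inter> path_image (\<beta> j) = {x}"
  shows "finite (components (S2 - (K \<union> (\<Union>i\<in>I. path_image (\<beta> i))))) \<and>
    card (components (S2 - (K \<union> (\<Union>i\<in>I. path_image (\<beta> i))))) \<le> card I \<and>
    path_connected (K \<union> (\<Union>i\<in>I. path_image (\<beta> i)))"
  using I \<beta> disj
proof (induction I rule: finite_ne_induct)
  case (singleton i)
  have b: "arc (\<beta> i)" "path_image (\<beta> i) \<subseteq> S2" "path_image (\<beta> i) \<inter> K = {pathfinish (\<beta> i)}" using singleton by auto
  have int: "K \<inter> path_image (\<beta> i) = {pathfinish (\<beta> i)}" using b(3) by blast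
  have "cc (K \<union> path_image (\<beta> i)) a a'" if "a \<in> S2 - (K \<union> path_image (\<beta> i))" "a' \<in> S2 - (K \<union> path_image (\<beta> i))" for a a'
  proof (rule Janiszewski_S2[OF K(1,2) closed_arc_image[OF b(1)] b(2)])
    show "connected (K \<inter> path_image (\<beta> i))" unfolding int by simp
    show "cc K a a'" using K(4) that connected_iff_connected_component by blast
    show "cc (path_image (\<beta> i)) a a'" using connected_arc_complement_S2[OF b(1,2)] that connected_iff_connected_component by blast
  qed
  then have "connected (S2 - (K \<union> path_image (\<beta> i)))" using connected_iff_connected_component by blast
  then have *: "components (S2 - (K \<union> path_image (\<beta> i))) \<subseteq> {S2 - (K \<union> path_image (\<beta> i))}" using connected_eq_components_subset_sing by blast
  have "path_connected (K \<union> path_image (\<beta> i))"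
    using b int by (intro path_connected_Un K(3) path_connected_path_image arc_imp_path) auto
  then show ?case using finite_subset[OF *] card_mono[OF _ *] by simp
next
  case (insert i I)
  define K' where "K' = K \<union> (\<Union>i\<in>I. path_image (\<beta> i))"
  have IH: "finite (components (S2 - K'))" "card (components (S2 - K')) \<le> card I" "path_connected K'"
    unfolding K'_def using insert by auto
  have b: "arc (\<beta> i)" "pathstart (\<beta> i) = x" "path_image (\<beta> i) \<subseteq> S2" "path_image (\<beta> i) \<inter> K = {pathfinish (\<beta> i)}" using insert.prems by auto
  have K': "closed K'" "K' \<subseteq> S2" unfolding K'_def using K insert by (auto intro!: closed_UN closed_arc_image)
  have d: "path_image (\<beta> i) \<inter> path_image (\<beta> j) = {x}" if "j \<in> I" for j using insert that by blast
  obtain j where "j \<in> I" using insert by blast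
  then have "path_image (\<beta> i) \<inter> K' = {pathstart (\<beta> i), pathfinish (\<beta> i)}"
    unfolding K'_def Int_Un_distrib b(4) using d b(2) by auto
  note * = add_arc_upper[OF K' IH(3) b(1,3) this IH(1)]
  have eq: "K \<union> (\<Union>i\<in>insert i I. path_image (\<beta> i)) = K' \<union> path_image (\<beta> i)" unfolding K'_def by blast
  have "path_connected (K' \<union> path_image (\<beta> i))"
    using b \<open>path_image (\<beta> i) \<inter> K' = _\<close> by (intro path_connected_Un IH(3) path_connected_path_image arc_imp_path) auto
  then show ?case unfolding eq using * IH(2) insert by auto
qed

text \<open>The sectors are components of the complement of a star together with its surrounding
  \<open>K\<close>, not components of \<open>N - D\<close>: an arc may re-enter \<open>N\<close>
  many times, so \<open>N - D\<close> can have far more of these. Points of \<open>N - D\<close> in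
  one sector may thus be joined only outside \<open>N\<close>, but still within
  \<open>W - D\<close>. Before \<open>star_setup\<close> applies, the arcs are shortened to meet in
  \<open>x\<close> alone, and the tails and \<open>Z\<close> are removed from the
  neighbourhood.\<close>

lemma sectors:
  assumes I: "finite I" "I \<noteq> {}"
    and arc: "\<And>i. i \<in> I \<Longrightarrow> arc (\<alpha> i) \<and> pathstart (\<alpha> i) = x \<and> path_image (\<alpha> i) \<subseteq> S2"
    and fin: "\<And>i j. i \<in> I \<Longrightarrow> j \<in> I \<Longrightarrow> i \<noteq> j \<Longrightarrow> finite (path_image (\<alpha> i) \<inter> path_image (\<alpha> j))"
    and W: "openin (top_of_set S2) W" "x \<in> W"
    and Z: "closed Z" "x \<notin> Z"
    and D: "(\<Union>i\<in>I. path_image (\<alpha> i)) \<subseteq> D" "D \<subseteq> (\<Union>i\<in>I. path_image (\<alpha> i)) \<union> Z"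
  obtains N \<Y> where "openin (top_of_set S2) N" "x \<in> N" "finite \<Y>" "card \<Y> \<le> card I" "N - D \<subseteq> \<Union>\<Y>"
    "\<And>Y a b. Y \<in> \<Y> \<Longrightarrow> a \<in> Y \<inter> (N - D) \<Longrightarrow> b \<in> Y \<inter> (N - D) \<Longrightarrow> connected_component (W - D) a b"
proof -
  define F where "F = (\<Union>i\<in>I. \<Union>j\<in>I - {i}. path_image (\<alpha> i) \<inter> path_image (\<alpha> j)) - {x}"
  have F: "finite F" "x \<notin> F" unfolding F_def using I(1) fin by (auto intro!: finite_Diff finite_UN_I simp del: finite_UN Int_UN_distrib UN_simps)
  have \<alpha>0: "\<alpha> i 0 = x" if "i \<in> I" for i using arc[OF that] by (simp add: pathstart_def)
  have "\<exists>\<tau>. 0 < \<tau> \<and> \<tau> \<le> 1 \<and> \<alpha> i ` {0..\<tau>} \<inter> F = {}" if i: "i \<in> I" for i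
  proof -
    define T where "T = {s \<in> {0..1}. \<alpha> i s \<in> F}"
    have "inj_on (\<alpha> i) T" using arc[OF i] by (auto simp: arc_def T_def inj_on_def)
    moreover have "\<alpha> i ` T \<subseteq> F" by (auto simp: T_def)
    ultimately have T: "finite (insert 1 T)" using inj_on_finite F(1) by blast
    \<comment> \<open>The arc is cut at half the first parameter that meets \<open>F\<close>; the
      inserted 1 covers arcs that never meet it.\<close>
    have "Min (insert 1 T) \<in> insert 1 T" using T Min_in by blast
    moreover have "0 \<notin> T" using \<alpha>0[OF i] F(2) by (auto simp: T_def)
    ultimately have pos: "Min (insert 1 T) > 0" by (auto simp: T_def order_less_le)
    have le: "Min (insert 1 T) \<le> s" if "s \<in> insert 1 T" for s using T that by simp
    show ?thesis
    proof (intro exI conjI)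
      show "0 < Min (insert 1 T) / 2" using pos by simp
      show "Min (insert 1 T) / 2 \<le> 1" using le[of 1] pos by simp
      show "\<alpha> i ` {0..Min (insert 1 T) / 2} \<inter> F = {}"
      proof -
        have "\<alpha> i s \<notin> F" if "s \<in> {0..Min (insert 1 T) / 2}" for s
          using le[of s] le[of 1] that pos by (auto simp: T_def)
        then show ?thesis by blast
      qed
    qed
  qed
  then obtain \<tau> where \<tau>: "\<And>i. i \<in> I \<Longrightarrow> 0 < \<tau> i \<and> \<tau> i \<le> 1 \<and> \<alpha> i ` {0..\<tau> i} \<inter> F = {}" by metis
  define \<alpha>' where "\<alpha>' i = subpath 0 (\<tau> i) (\<alpha> i)" for i
  define \<rho> where "\<rho> i = \<alpha> i ` {\<tau> i..1}" for i
  have im: "path_image (\<alpha>' i) = \<alpha> i ` {0..\<tau> i}" if "i \<in> I" for i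
    using \<tau>[OF that] by (simp add: \<alpha>'_def path_image_subpath)
  have \<alpha>im: "path_image (\<alpha> i) = path_image (\<alpha>' i) \<union> \<rho> i" if "i \<in> I" for i
  proof -
    have "{0..1} = {0..\<tau> i} \<union> {\<tau> i..1}" using \<tau>[OF that] by auto
    then show ?thesis using im[OF that] by (simp add: \<rho>_def path_image_def flip: image_Un)
  qed
  have inj: "\<alpha> i s \<noteq> \<alpha> i s'" if "i \<in> I" "s \<in> {0..1}" "s' \<in> {0..1}" "s \<noteq> s'" for i s s'
    using arc[OF that(1)] that by (auto simp: arc_def inj_on_def)
  have x\<rho>: "x \<notin> \<rho> i" if "i \<in> I" for i
  proof
    assume "x \<in> \<rho> i"
    then obtain s where "s \<in> {\<tau> i..1}" "x = \<alpha> i s" by (auto simp: \<rho>_def)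
    then show False using inj[OF that, of 0 s] \<alpha>0[OF that] \<tau>[OF that] by simp
  qed
  have \<rho>cl: "closed (\<rho> i)" if i: "i \<in> I" for i
  proof -
    have "continuous_on {\<tau> i..1} (\<alpha> i)" using arc[OF i] \<tau>[OF i] 
      by (auto simp: arc_def path_def elim!: continuous_on_subset)
    then show ?thesis unfolding \<rho>_def by (simp add: compact_continuous_image compact_imp_closed)
  qed
  have arc': "arc (\<alpha>' i) \<and> pathstart (\<alpha>' i) = x \<and> path_image (\<alpha>' i) \<subseteq> S2" if i: "i \<in> I" for i
  proof (intro conjI)
    show "arc (\<alpha>' i)" unfolding \<alpha>'_def using arc[OF i] \<tau>[OF i] by (intro arc_subpath_arc) (auto simp: arc_def dest: inj[OF i])
    show "pathstart (\<alpha>' i) = x" using \<alpha>0[OF i] by (simp add: \<alpha>'_def)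
  qed (use \<alpha>im[OF i] arc[OF i] in blast)
  have disj: "path_image (\<alpha>' i) \<inter> path_image (\<alpha>' j) = {x}" if ij: "i \<in> I" "j \<in> I" "i \<noteq> j" for i j
  proof -
    have "path_image (\<alpha>' i) \<inter> path_image (\<alpha>' j) \<subseteq> insert x F" unfolding F_def using \<alpha>im ij by blast
    moreover have "path_image (\<alpha>' i) \<inter> F = {}" using im \<tau> ij by simp
    moreover have "x \<in> path_image (\<alpha>' i) \<inter> path_image (\<alpha>' j)"
      using arc'[OF ij(1)] arc'[OF ij(2)] pathstart_in_path_image[of "\<alpha>' i"] pathstart_in_path_image[of "\<alpha>' j"] by auto
    ultimately show ?thesis by blast
  qed
  define W' where "W' = W \<inter> (S2 - (Z \<union> (\<Union>i\<in>I. \<rho> i)))"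
  have W': "openin (top_of_set S2) W'" unfolding W'_def using Z(1) \<rho>cl I
    by (intro openin_Int W(1) openin_S2_compl) auto
  have xW': "x \<in> W'" unfolding W'_def using W Z(2) x\<rho> openin_imp_subset[OF W(1)] by blast
  have D': "D \<inter> W' \<subseteq> (\<Union>i\<in>I. path_image (\<alpha>' i))"
  proof
    fix y assume y: "y \<in> D \<inter> W'"
    then have "y \<notin> Z" "\<forall>i\<in>I. y \<notin> \<rho> i" by (auto simp: W'_def)
    then obtain i where i: "i \<in> I" "y \<in> path_image (\<alpha> i)" using D(2) y by blast
    then have "y \<in> path_image (\<alpha>' i)" using \<alpha>im[OF i(1)] \<open>\<forall>i\<in>I. y \<notin> \<rho> i\<close> by blast
    then show "y \<in> (\<Union>i\<in>I. path_image (\<alpha>' i))" using i by blast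
  qed
  obtain K \<beta> N where K: "closed K" "K \<subseteq> S2" "path_connected K" "K \<noteq> {}" "x \<notin> K" "connected (S2 - K)"
    and \<beta>': "\<forall>i\<in>I. arc (\<beta> i) \<and> pathstart (\<beta> i) = x \<and> path_image (\<beta> i) \<subseteq> path_image (\<alpha>' i)
       \<and> path_image (\<beta> i) \<inter> K = {pathfinish (\<beta> i)}"
    and N: "openin (top_of_set S2) N" "x \<in> N" "N \<subseteq> W' - K" "N \<inter> D \<subseteq> (\<Union>i\<in>I. path_image (\<beta> i))"
    and NN: "\<forall>a\<in>N - D. \<forall>b\<in>N - D. cc (K \<union> (\<Union>i\<in>I. path_image (\<beta> i))) a b
      \<longrightarrow> connected_component (W' - D) a b"
    by (rule star_setup[of I \<alpha>' x W' D, OF I(1) arc' disj W' xW' D'])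
  note \<beta> = bspec[OF \<beta>']
  define S where "S = K \<union> (\<Union>i\<in>I. path_image (\<beta> i))"
  have "x \<in> path_image (\<beta> i)" if "i \<in> I" for i using \<beta>[OF that] pathstart_in_path_image[of "\<beta> i"] by simp
  then have dj: "path_image (\<beta> i) \<inter> path_image (\<beta> j) = {x}" if "i \<in> I" "j \<in> I" "i \<noteq> j" for i j
    using \<beta>[OF that(1)] \<beta>[OF that(2)] disj[OF that] that by auto
  have "path_image (\<beta> i) \<subseteq> S2" if "i \<in> I" for i using \<beta>[OF that] arc'[OF that] by blast
  then have Y: "finite (components (S2 - S))" "card (components (S2 - S)) \<le> card I"
    using star_components[OF K(1-3,6,5) I, of \<beta>] \<beta> dj unfolding S_def by auto
  have "path_image (\<beta> i) \<subseteq> D" if "i \<in> I" for i using \<beta>[OF that] \<alpha>im[OF that] D(1) that by blast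
  then have "(\<Union>i\<in>I. path_image (\<beta> i)) \<subseteq> D" by blast
  then have "N - D \<subseteq> S2 - S" using N(3) openin_imp_subset[OF N(1)] unfolding S_def by blast
  then have cover: "N - D \<subseteq> \<Union>(components (S2 - S))" by (simp only: Union_components)
  have join: "connected_component (W - D) a b"
    if Y: "Y \<in> components (S2 - S)" "a \<in> Y \<inter> (N - D)" "b \<in> Y \<inter> (N - D)" for Y a b
  proof -
    have "cc S a b" using cc_if_component[OF Y(1)] Y by blast
    then have "connected_component (W' - D) a b" using NN Y unfolding S_def by blast
    moreover have "W' - D \<subseteq> W - D" by (auto simp: W'_def)
    ultimately show ?thesis by (rule connected_component_of_subset)
  qed
  show ?thesis by (rule that[OF N(1,2) Y cover join])
qed

text \<open>The two halves of \<open>c\<close> at \<open>c t\<close>, cut at their first hits of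
  \<open>K\<close>, form one arc with its ends on \<open>K\<close>, so there are only two sides near
  \<open>c t\<close>. A cell that comes close to \<open>c t\<close> fills the part of its side in a
  neighbourhood, and all of \<open>J\<close> is in the closure of that side.\<close>

lemma arc_local_closure:
  assumes c: "arc c" "path_image c \<subseteq> S2" and t: "0 < t" "t < 1"
    and Z: "closed Z" "c t \<notin> Z"
    and D: "path_image c \<subseteq> D" "D \<subseteq> path_image c \<union> Z"
    and C: "C \<in> components (S2 - D)" "c t \<in> closure C"
  obtains N where "openin (top_of_set S2) N" "c t \<in> N" "N \<inter> path_image c \<subseteq> closure C"
proof -
  define x where "x = c t"
  define \<alpha> where "\<alpha> b = (if b then subpath t 1 c else subpath t 0 c)" for b
  define W where "W = S2 - Z"
  have im: "path_image (\<alpha> True) = c ` {t..1}" "path_image (\<alpha> False) = c ` {0..t}"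
    using t by (auto simp: \<alpha>_def path_image_subpath)
  have inj: "inj_on c {0..1}" using c(1) by (simp add: arc_def)
  have cim: "path_image c = (\<Union>i. path_image (\<alpha> i))"
  proof -
    have "{0..1} = {0..t} \<union> {t..1}" using t by auto
    then show ?thesis using im by (simp add: path_image_def UNIV_bool flip: image_Un)
  qed
  have arc: "arc (\<alpha> i) \<and> pathstart (\<alpha> i) = x \<and> path_image (\<alpha> i) \<subseteq> S2" for i
  proof -
    have "path_image (\<alpha> i) \<subseteq> S2" using cim c(2) by blast
    moreover have "arc (\<alpha> i)" using t by (auto simp: \<alpha>_def intro!: arc_subpath_arc[OF c(1)])
    ultimately show ?thesis by (auto simp: \<alpha>_def x_def)
  qed
  have "c ` {t..1} \<inter> c ` {0..t} = c ` ({t..1} \<inter> {0..t})"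
    using t by (intro inj_on_image_Int[OF inj, symmetric]) auto
  also have "{t..1} \<inter> {0..t} = {t}" using t by auto
  finally have TF: "path_image (\<alpha> True) \<inter> path_image (\<alpha> False) = {x}" using im by (simp add: x_def)
  then have disj: "path_image (\<alpha> i) \<inter> path_image (\<alpha> j) = {x}" if "i \<noteq> j" for i j
    using that by (cases i; cases j) auto
  have W: "openin (top_of_set S2) W" "x \<in> W"
    unfolding W_def x_def using Z c(2) t openin_S2_compl by (auto simp: path_image_def)
  have D': "D \<inter> W \<subseteq> (\<Union>i. path_image (\<alpha> i))" using D(2) cim by (auto simp: W_def)
  obtain K \<beta> N where K: "closed K" "K \<subseteq> S2" "path_connected K" "K \<noteq> {}" "x \<notin> K" "connected (S2 - K)"
    and \<beta>: "\<And>i. arc (\<beta> i) \<and> pathstart (\<beta> i) = x \<and> path_image (\<beta> i) \<subseteq> path_image (\<alpha> i)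
       \<and> path_image (\<beta> i) \<inter> K = {pathfinish (\<beta> i)}"
    and N: "openin (top_of_set S2) N" "x \<in> N" "N \<subseteq> W - K" "N \<inter> D \<subseteq> (\<Union>i. path_image (\<beta> i))"
    and NN: "\<And>a b. a \<in> N - D \<Longrightarrow> b \<in> N - D \<Longrightarrow> cc (K \<union> (\<Union>i. path_image (\<beta> i))) a b
      \<Longrightarrow> connected_component (W - D) a b"
    using star_setup[of UNIV \<alpha> x W D, OF _ arc disj W D'] by (metis UNIV_I finite)
  define b where "b = reversepath (\<beta> True) +++ \<beta> False"
  have \<beta>TF: "path_image (\<beta> True) \<inter> path_image (\<beta> False) = {x}"
    using TF \<beta>[of True] \<beta>[of False] pathstart_in_path_image[of "\<beta> True"] pathstart_in_path_image[of "\<beta> False"] by auto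
  have b: "arc b" unfolding b_def using \<beta> \<beta>TF by (intro arc_join) (auto simp: arc_reversepath)
  have bim: "path_image b = (\<Union>i. path_image (\<beta> i))"
    unfolding b_def using \<beta> by (subst path_image_join) (auto simp: UNIV_bool)
  have bD: "path_image b \<subseteq> path_image c" unfolding bim cim using \<beta> by blast
  have bK: "path_image b \<inter> K = {pathstart b, pathfinish b}"
    unfolding bim using \<beta>[of True] \<beta>[of False] by (auto simp: b_def UNIV_bool)
  obtain J A B where J: "closed J" "J \<subseteq> S2" "connected (K \<inter> J)" "K \<union> J = K \<union> path_image b" "path_image b \<subseteq> J"
    and AB: "components (S2 - J) = {A, B}" "J \<subseteq> closure A" "J \<subseteq> closure B"
    by (rule add_arc_setup[OF K(1-3) b order_trans[OF bD c(2)] bK])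
  have join: "connected_component (W - D) y z"
    if yz: "y \<in> N - D" "z \<in> N - D" "E \<in> {A, B}" "y \<in> E" "z \<in> E" for y z E
  proof -
    have "cc K y z" using K(6) yz N(3) unfolding connected_component_def W_def by blast
    moreover have "cc J y z" using cc_if_component[of E J y z] AB yz by blast
    ultimately have "cc (K \<union> J) y z" by (rule Janiszewski_S2[OF K(1,2) J(1-3)])
    then show ?thesis using NN yz J(4) bim by simp
  qed
  obtain T where T: "open T" "N = S2 \<inter> T" using N(1) by (auto simp: openin_open)
  have CS: "C \<subseteq> S2 - D" using in_components_subset[OF C(1)] .
  obtain y where y: "y \<in> C" "y \<in> T"
    using C(2) T N(2) unfolding x_def by (metis IntD2 closure_iff_nhds_not_empty disjoint_iff order_refl)
  then have yN: "y \<in> N - D" using CS T by blast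
  have notJ: "z \<notin> J" if "z \<in> N - D" for z
    using that N(3) J(4) bD D(1) by blast
  have "y \<in> S2 - J" using notJ[OF yN] CS y by blast
  then have "y \<in> \<Union>(components (S2 - J))" by (simp only: Union_components)
  then obtain E where E: "E \<in> {A, B}" "y \<in> E" using AB(1) by blast
  have EJ: "E \<subseteq> S2 - J" using E AB(1) in_components_subset by blast
  \<comment> \<open>Points of \<open>N\<close> on the same side \<open>E\<close> as \<open>y\<close>
    are joined to \<open>y\<close> off \<open>D\<close>, so they belong to the component
    \<open>C\<close> of \<open>y\<close>.\<close>
  have NEC: "N \<inter> E \<subseteq> C"
  proof
    fix z assume z: "z \<in> N \<inter> E"
    then have "z \<notin> path_image b" using EJ J(5) by blast
    then have zN: "z \<in> N - D" using z N(4) bim by blast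
    then have "connected_component (W - D) y z" using join[OF yN zN E(1) E(2)] z by blast
    moreover have "W - D \<subseteq> S2 - D" by (auto simp: W_def)
    ultimately obtain U where U: "connected U" "U \<subseteq> S2 - D" "y \<in> U" "z \<in> U"
      unfolding connected_component_def by blast
    then have "U \<subseteq> C" using y(1) by (intro components_maximal[OF C(1)]) auto
    then show "z \<in> C" using U by blast
  qed
  have "N \<inter> path_image c \<subseteq> closure C"
  proof
    fix z assume z: "z \<in> N \<inter> path_image c"
    then have "z \<in> J" using N(4) D(1) J(5) bim by blast
    then have "z \<in> closure E" using AB E by blast
    moreover have "z \<in> T" using z T by blast
    ultimately have "z \<in> closure (T \<inter> E)" using T(1) open_Int_closure_subset by blast
    moreover have "T \<inter> E \<subseteq> C" using NEC EJ T by blast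
    ultimately show "z \<in> closure C" using closure_mono by blast
  qed
  then show ?thesis using that N(1,2) unfolding x_def by blast
qed

section \<open>A lower bound for the number of cells\<close>

text \<open>The hits of \<open>c\<close> on \<open>K\<close> cut it into one segment fewer than
  there are hits, and each segment splits a component. What follows the last hit hangs loose and
  cannot reduce the number of components. The induction on the number of hits peels off the last
  segment.\<close>

lemma add_crossing_arc_lower:
  assumes K: "closed K" "K \<subseteq> S2" "path_connected K"
    and c: "arc c" "path_image c \<subseteq> S2" "pathstart c \<in> K" "finite (path_image c \<inter> K)"
    and fin: "finite (components (S2 - (K \<union> path_image c)))"
  shows "finite (components (S2 - K)) \<and>
    card (components (S2 - K)) + card (path_image c \<inter> K) \<le> card (components (S2 - (K \<union> path_image c))) + 1"
  using c fin
proof (induction "card (path_image c \<inter> K)" arbitrary: c rule: less_induct)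
  case less
  note c = less.prems(1-4)
  define P where "P = {s \<in> {0..1}. c s \<in> K}"
  have inj: "inj_on c {0..1}" using c(1) by (simp add: arc_def)
  then have injP: "inj_on c P" by (rule inj_on_subset) (auto simp: P_def)
  have cP: "path_image c \<inter> K = c ` P" by (auto simp: P_def path_image_def)
  have P: "finite P" "0 \<in> P" using c(3,4) injP cP finite_imageD by (auto simp: P_def pathstart_def)
  have cardP: "card (path_image c \<inter> K) = card P" using cP injP card_image by simp
  show ?case
  proof (cases "P = {0}")
    case True
    then show ?thesis using add_dangling_lower[OF K(1,2) c(1) less.prems(5)] cardP by simp
  next
    case False
    \<comment> \<open>\<open>t'\<close> and \<open>t\<close> are the parameters of the last two
      hits, so the segment between them meets \<open>K\<close> together with the earlier part of
      \<open>c\<close> only at its ends.\<close>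
    define t where "t = Max P"
    define t' where "t' = Max (P - {t})"
    have t: "t \<in> P" "\<And>s. s \<in> P \<Longrightarrow> s \<le> t" using P by (auto simp: t_def intro: Max_in)
    then have "t \<noteq> 0" using False P(2) by (force simp: P_def)
    then have "P - {t} \<noteq> {}" using P(2) by blast
    then have t': "t' \<in> P" "t' \<noteq> t" "\<And>s. s \<in> P - {t} \<Longrightarrow> s \<le> t'" 
      using P(1) Max_in[of "P - {t}"] unfolding t'_def by auto
    have tt: "0 \<le> t'" "t' < t" "t \<le> 1" using t t' by (auto simp: P_def order_less_le)
    define K1 where "K1 = K \<union> c ` {0..t'}"
    define K2 where "K2 = K \<union> c ` {0..t}"
    have cont: "continuous_on {a..b} c" if "0 \<le> a" "b \<le> 1" for a b
      using c(1) that by (auto simp: arc_def path_def elim!: continuous_on_subset)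
    have K12: "closed K1" "closed K2" unfolding K1_def K2_def using K(1) tt
      by (auto intro!: closed_Un compact_imp_closed[OF compact_continuous_image] cont)
    have K12s: "K1 \<subseteq> S2" "K2 \<subseteq> S2" unfolding K1_def K2_def using K(2) c(2) tt by (auto simp: path_image_def)
    have c0: "c 0 \<in> K \<inter> c ` {0..t'}" using c(3) tt by (auto simp: pathstart_def)
    have "path_connected (c ` {0..t'})" using tt
      by (intro path_connected_continuous_image cont) (auto simp: is_interval_path_connected_1[symmetric] is_interval_cc)
    then have K1p: "path_connected K1" unfolding K1_def using c0 by (intro path_connected_Un K(3)) auto
    define c2 where "c2 = subpath t' t c"
    have c2: "arc c2" "path_image c2 = c ` {t'..t}" "pathstart c2 = c t'" "pathfinish c2 = c t"
      using tt by (auto simp: c2_def path_image_subpath intro!: arc_subpath_arc[OF c(1)])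
    have c2s: "path_image c2 \<subseteq> S2" using c(2) tt unfolding c2 by (auto simp: path_image_def)
    have "{0..t} = {0..t'} \<union> {t'..t}" using tt by auto
    then have K2eq: "K2 = K1 \<union> path_image c2" unfolding K1_def K2_def c2 by (auto simp flip: image_Un)
    have "path_image c2 \<inter> K1 = {pathstart c2, pathfinish c2}"
    proof -
      have "s = t' \<or> s = t" if s: "s \<in> {t'..t}" "c s \<in> K1" for s
      proof (cases "c s \<in> K")
        case True
        then have "s \<in> P" using s tt by (auto simp: P_def)
        then show ?thesis using t'(3)[of s] s by force
      next
        case False
        then obtain r where "r \<in> {0..t'}" "c s = c r" using s(2) by (auto simp: K1_def)
        then have "s = r" using inj s tt by (auto simp: inj_on_def)
        then show ?thesis using \<open>r \<in> {0..t'}\<close> s by auto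
      qed
      moreover have "c t' \<in> K1" "c t \<in> K1" using t t' by (auto simp: K1_def P_def)
      ultimately show ?thesis unfolding c2 using tt by force
    qed
    note B = add_arc_lower[OF K12(1) K12s(1) K1p c2(1) c2s this, folded K2eq]
    have A: "finite (components (S2 - K2)) \<and> card (components (S2 - K2)) \<le> card (components (S2 - (K \<union> path_image c)))"
    proof (cases "t = 1")
      case True
      then show ?thesis using less.prems(5) by (simp add: K2_def path_image_def)
    next
      case False
      have "arc (subpath t 1 c)" using tt False by (auto intro!: arc_subpath_arc[OF c(1)])
      moreover have "{0..1} = {0..t} \<union> {t..1}" using tt by auto
      then have "K2 \<union> path_image (subpath t 1 c) = K \<union> path_image c"
        using tt by (auto simp: K2_def path_image_def[of c] path_image_subpath simp flip: image_Un)
      ultimately show ?thesis using add_dangling_lower[OF K12(2) K12s(2), of "subpath t 1 c"] less.prems(5) by simp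
    qed
    have C: "finite (components (S2 - K1))" "card (components (S2 - K1)) + 1 \<le> card (components (S2 - K2))"
      using B A by auto
    have "finite (components (S2 - K)) \<and> card (components (S2 - K)) + card (P - {t}) \<le> card (components (S2 - K1)) + 1"
    proof (cases "t' = 0")
      \<comment> \<open>There is no initial part to which the induction hypothesis could be applied:
        \<open>subpath 0 0 c\<close> is constant and not an arc.\<close>
      case True
      have "P - {t} = {0}" using t'(3) True P(2) \<open>t \<noteq> 0\<close> by (force simp: P_def)
      moreover have "K1 = K" using c0 True by (auto simp: K1_def)
      ultimately show ?thesis using C(1) by simp
    next
      case False
      define c1 where "c1 = subpath 0 t' c"
      have c1: "arc c1" "path_image c1 = c ` {0..t'}" "pathstart c1 \<in> K"
        using tt False c(3) c0 by (auto simp: c1_def path_image_subpath intro!: arc_subpath_arc[OF c(1)])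
      have "{s \<in> {0..t'}. c s \<in> K} = P - {t}" using tt t'(3) by (auto simp: P_def)
      then have "path_image c1 \<inter> K = c ` (P - {t})" unfolding c1 by blast
      then have c1K: "finite (path_image c1 \<inter> K)" "card (path_image c1 \<inter> K) = card (P - {t})"
        using P(1) injP by (auto simp: card_image inj_on_diff)
      have "card (P - {t}) < card P" using P(1) t(1) by (rule card_Diff1_less)
      moreover have "path_image c1 \<subseteq> S2" using c(2) tt unfolding c1 by (auto simp: path_image_def)
      ultimately show ?thesis using less.hyps[of c1] c1 c1K cardP C(1) unfolding K1_def by simp
    qed
    moreover have "card (P - {t}) + 1 = card P" using P(1) t(1) by (metis Suc_eq_plus1 card.remove)
    ultimately show ?thesis using C A cardP by auto
  qed
qed

section \<open>Partial drawings of a connected graph and one half of Euler's formula\<close>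

locale sphere_drawing =
  fixes V :: "'v set" and E :: "'e set" and ends :: "'e \<Rightarrow> 'v set"
    and pos :: "'v \<Rightarrow> pt" and \<gamma> :: "'e \<Rightarrow> real \<Rightarrow> pt"
  assumes graph: "multigraph V E ends" and conn: "graph_connected V E ends" and V3: "card V \<ge> 3"
    and draw: "drawing V E ends pos \<gamma>"
begin

lemma finite_VE: "finite V" "finite E" using graph by (auto simp: multigraph_def)

lemma ends: "e \<in> E \<Longrightarrow> ends e \<subseteq> V" "e \<in> E \<Longrightarrow> card (ends e) = 2" using graph by (auto simp: multigraph_def)

lemma inj_pos: "inj_on pos V" and pos_S2: "pos ` V \<subseteq> S2" using draw by (auto simp: drawing_def)

lemma edge:
  assumes "e \<in> E"
  shows "arc (\<gamma> e)" "path_image (\<gamma> e) \<subseteq> S2" "{pathstart (\<gamma> e), pathfinish (\<gamma> e)} = pos ` ends e"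
    "path_image (\<gamma> e) \<inter> pos ` V = pos ` ends e" "closed (path_image (\<gamma> e))"
proof -
  show 1: "arc (\<gamma> e)" "path_image (\<gamma> e) \<subseteq> S2" "{pathstart (\<gamma> e), pathfinish (\<gamma> e)} = pos ` ends e"
    and "closed (path_image (\<gamma> e))"
    using draw assms by (auto simp: drawing_def closed_arc_image)
  have "path_image (\<gamma> e) \<inter> pos ` V \<subseteq> pos ` ends e" using draw assms by (auto simp: drawing_def)
  moreover have "pos ` ends e \<subseteq> path_image (\<gamma> e)" unfolding 1(3)[symmetric]
    using pathstart_in_path_image pathfinish_in_path_image by blast
  moreover have "pos ` ends e \<subseteq> pos ` V" using ends(1)[OF assms] by blast
  ultimately show "path_image (\<gamma> e) \<inter> pos ` V = pos ` ends e" by blast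
qed

lemma finite_inter: "e \<in> E \<Longrightarrow> f \<in> E \<Longrightarrow> e \<noteq> f \<Longrightarrow> finite (path_image (\<gamma> e) \<inter> path_image (\<gamma> f))"
  using draw by (simp add: drawing_def)

lemma no_triple:
  assumes "e \<in> E" "f \<in> E" "g \<in> E" "e \<noteq> f" "e \<noteq> g" "f \<noteq> g"
  shows "path_image (\<gamma> e) \<inter> path_image (\<gamma> f) \<inter> path_image (\<gamma> g) \<subseteq> pos ` V"
  using draw assms unfolding drawing_def by blast

text \<open>Vertices enter a partial drawing only with their edges. Those not reached yet would be
  isolated points and destroy path-connectedness. For the full edge set nothing is lost, as every
  vertex has an edge.\<close>

definition img :: "'e set \<Rightarrow> pt set" where "img F = (\<Union>e\<in>F. path_image (\<gamma> e))"

definition crossings :: "'e set \<Rightarrow> pt set" where "crossings F = {x. is_crossing V F pos \<gamma> x}"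

lemma img_S2: "F \<subseteq> E \<Longrightarrow> img F \<subseteq> S2" using edge(2) by (auto simp: img_def)

lemma closed_img: "F \<subseteq> E \<Longrightarrow> closed (img F)"
  unfolding img_def using finite_VE(2) finite_subset edge(5) by (intro closed_UN) blast+

lemma pos_in_edge_iff: "e \<in> E \<Longrightarrow> v \<in> V \<Longrightarrow> pos v \<in> path_image (\<gamma> e) \<longleftrightarrow> v \<in> ends e"
proof -
  assume e: "e \<in> E" "v \<in> V"
  have "pos v \<in> path_image (\<gamma> e) \<longleftrightarrow> pos v \<in> pos ` ends e" using edge(4)[OF e(1)] e(2) by blast
  then show ?thesis using inj_on_image_mem_iff[OF inj_pos e(2) ends(1)[OF e(1)]] by simp
qed

lemma finite_crossings: "finite (crossings E)"
proof -
  have "crossings E \<subseteq> (\<Union>e\<in>E. \<Union>f\<in>E - {e}. path_image (\<gamma> e) \<inter> path_image (\<gamma> f))"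
    by (auto simp: crossings_def is_crossing_def)
  moreover have "finite (\<Union>e\<in>E. \<Union>f\<in>E - {e}. path_image (\<gamma> e) \<inter> path_image (\<gamma> f))"
    using finite_VE finite_inter by (intro finite_UN_I) auto
  ultimately show ?thesis by (rule finite_subset)
qed

lemma crossings_mono: "F \<subseteq> G \<Longrightarrow> crossings F \<subseteq> crossings G"
  by (auto simp: crossings_def is_crossing_def)

text \<open>A crossing on the new edge \<open>e\<close> is not an old one, since three edges would
  meet there.\<close>

lemma crossings_insert:
  assumes "F \<subseteq> E" "e \<in> E - F"
  shows "card (crossings (insert e F)) = card (crossings F) + card (path_image (\<gamma> e) \<inter> img F - pos ` V)"
proof -
  let ?Y = "path_image (\<gamma> e) \<inter> img F - pos ` V"
  have "crossings (insert e F) = crossings F \<union> ?Y"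
    using assms by (auto simp: crossings_def is_crossing_def img_def)
  moreover have "crossings F \<inter> ?Y = {}"
  proof -
    have False if x: "x \<in> crossings F" "x \<in> ?Y" for x
    proof -
      obtain f g where "f \<in> F" "g \<in> F" "f \<noteq> g" "x \<in> path_image (\<gamma> f)" "x \<in> path_image (\<gamma> g)"
        using x(1) by (auto simp: crossings_def is_crossing_def)
      moreover from this have "e \<noteq> f" "e \<noteq> g" "f \<in> E" "g \<in> E" using assms by auto
      ultimately show False using no_triple[of e f g] x(2) assms by blast
    qed
    then show ?thesis by blast
  qed
  moreover have "finite (crossings (insert e F))"
    using finite_subset[OF crossings_mono finite_crossings] assms by simp
  ultimately show ?thesis by (metis card_Un_disjoint finite_Un)
qed

lemma exists_edge:
  assumes v: "v \<in> V" shows "\<exists>e\<in>E. v \<in> ends e"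
proof -
  have "V \<noteq> {v}" using V3 by auto
  then obtain w where w: "w \<in> V" "w \<noteq> v" using v by blast
  then have "(\<lambda>x y. \<exists>e\<in>E. ends e = {x, y})\<^sup>*\<^sup>* v w" using conn v by (simp add: graph_connected_def)
  then obtain y where "\<exists>e\<in>E. ends e = {v, y}" using w(2) by (cases rule: converse_rtranclpE) auto
  then show ?thesis by blast
qed

lemma exists_adjacent_edge:
  assumes F: "F \<subset> E" "F \<noteq> {}"
  shows "\<exists>e\<in>E - F. ends e \<inter> \<Union>(ends ` F) \<noteq> {}"
proof (cases "\<Union>(ends ` F) = V")
  case True
  obtain e where e: "e \<in> E - F" using F by blast
  then have "ends e \<subseteq> V" "ends e \<noteq> {}" using ends[of e] by auto
  then show ?thesis using True e by blast
next
  case False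
  have sub: "\<Union>(ends ` F) \<subseteq> V" using F ends(1) by blast
  then obtain w where w: "w \<in> V" "w \<notin> \<Union>(ends ` F)" using False by blast
  obtain f where "f \<in> F" using F by blast
  then have "ends f \<noteq> {}" using ends(2)[of f] F by auto
  then obtain u where u: "u \<in> \<Union>(ends ` F)" using \<open>f \<in> F\<close> by blast
  have "(\<lambda>x y. \<exists>e\<in>E. ends e = {x, y})\<^sup>*\<^sup>* u w" using conn u w sub by (auto simp: graph_connected_def)
  then show ?thesis using u w(2)
  proof (induction rule: converse_rtranclp_induct)
    case (step y z)
    then obtain e where e: "e \<in> E" "ends e = {y, z}" by blast
    show ?case
    proof (cases "z \<in> \<Union>(ends ` F)")
      case False
      then have "e \<notin> F" using e by blast
      then show ?thesis using e step by blast
    qed (use step in blast)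
  qed blast
qed

lemma finite_Vof: "F \<subseteq> E \<Longrightarrow> finite (\<Union>(ends ` F))"
  using finite_VE ends(1) by (meson UN_least finite_subset subset_iff)

text \<open>Edges are added so that each has an end among the vertices reached before. A new edge
  with \<open>x\<close> new crossings and \<open>o\<close> ends already reached has
  \<open>x + o\<close> hits on the old drawing. It adds at least \<open>x + o - 1\<close> cells and
  exactly \<open>2 - o\<close> vertices, which pays for one edge and \<open>x\<close> crossings. A
  single edge starts the induction with \<open>1 + 0 + 2 \<le> 1 + 2\<close>.\<close>

lemma many_cells_subgraph:
  assumes "1 \<le> j" "j \<le> card E"
  shows "\<exists>F \<subseteq> E. card F = j \<and> path_connected (img F) \<and> (finite (components (S2 - img F)) \<longrightarrow>
    j + card (crossings F) + 2 \<le> card (components (S2 - img F)) + card (\<Union>(ends ` F)))"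
  using assms
proof (induction j rule: nat_induct_at_least)
  case base
  then have "E \<noteq> {}" by auto
  then obtain e where e: "e \<in> E" by blast
  have "crossings {e} = {}" by (auto simp: crossings_def is_crossing_def)
  moreover have "components (S2 - img {e}) \<noteq> {}"
  proof -
    have "openin (top_of_set S2) S2" "S2 \<noteq> {}" by auto
    then have "\<not> S2 \<subseteq> img {e}" using arc_empty_interior_S2[OF edge(1)[OF e]] by (auto simp: img_def)
    then show ?thesis by (simp add: Diff_eq_empty_iff)
  qed
  then have "1 \<le> card (components (S2 - img {e}))" if "finite (components (S2 - img {e}))"
    using that by (simp add: Suc_leI card_gt_0_iff)
  moreover have "path_connected (img {e})" using edge(1)[OF e] by (simp add: img_def arc_imp_path path_connected_path_image)
  ultimately show ?case using e ends(2)[OF e] by (intro exI[of _ "{e}"]) auto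
next
  case (Suc j)
  then obtain F where F: "F \<subseteq> E" "card F = j" "path_connected (img F)"
    and IH: "finite (components (S2 - img F)) \<Longrightarrow>
      j + card (crossings F) + 2 \<le> card (components (S2 - img F)) + card (\<Union>(ends ` F))" by auto
  have "F \<subset> E" "F \<noteq> {}" using F Suc by auto
  then obtain e where e: "e \<in> E - F" "ends e \<inter> \<Union>(ends ` F) \<noteq> {}" using exists_adjacent_edge[OF \<open>F \<subset> E\<close> \<open>F \<noteq> {}\<close>] by blast
  then have eE: "e \<in> E" by blast
  let ?VF = "\<Union>(ends ` F)"
  have VF: "?VF \<subseteq> V" using F ends(1) by blast
  have finF: "finite F" using F(1) finite_VE finite_subset by blast
  obtain u where u: "u \<in> ends e" "u \<in> ?VF" using e(2) by blast
  then have uF: "pos u \<in> img F" using F pos_in_edge_iff VF by (force simp: img_def)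
  \<comment> \<open>The edge is oriented to start at a vertex already drawn, as
    \<open>add_crossing_arc_lower\<close> demands.\<close>
  define c where "c = (if pathstart (\<gamma> e) = pos u then \<gamma> e else reversepath (\<gamma> e))"
  have "pos u \<in> {pathstart (\<gamma> e), pathfinish (\<gamma> e)}" using edge(3)[OF eE] u by blast
  then have c: "arc c" "path_image c = path_image (\<gamma> e)" "pathstart c \<in> img F"
    using edge(1)[OF eE] uF by (auto simp: c_def arc_reversepath)
  have "path_image (\<gamma> e) \<inter> img F = (\<Union>f\<in>F. path_image (\<gamma> e) \<inter> path_image (\<gamma> f))" by (auto simp: img_def)
  moreover have "finite (\<Union>f\<in>F. path_image (\<gamma> e) \<inter> path_image (\<gamma> f))"
    using finite_inter[OF eE] F(1) e by (intro finite_UN_I[OF finF]) blast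
  ultimately have fin: "finite (path_image (\<gamma> e) \<inter> img F)" by simp
  have img_ins: "img (insert e F) = img F \<union> path_image c" unfolding c(2) by (auto simp: img_def)
  have "pos ` V \<inter> (path_image (\<gamma> e) \<inter> img F) = pos ` (ends e \<inter> ?VF)"
  proof -
    have "pos v \<in> path_image (\<gamma> e) \<inter> img F \<longleftrightarrow> v \<in> ends e \<inter> ?VF" if "v \<in> V" for v
      using pos_in_edge_iff[OF _ that] eE F(1) by (auto simp: img_def)
    then show ?thesis using VF by blast
  qed
  moreover have "inj_on pos (ends e \<inter> ?VF)" using inj_on_subset[OF inj_pos] VF by blast
  ultimately have i: "card (path_image (\<gamma> e) \<inter> img F \<inter> pos ` V) = card (ends e \<inter> ?VF)"
    by (metis card_image inf_commute)
  have split: "card (path_image (\<gamma> e) \<inter> img F) = card (path_image (\<gamma> e) \<inter> img F - pos ` V) + card (ends e \<inter> ?VF)"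
    using card_Int_Diff[OF fin, of "pos ` V"] i by simp
  have "card (\<Union>(ends ` insert e F)) + card (ends e \<inter> ?VF) = 2 + card ?VF"
    using card_Un_Int[of "ends e" ?VF] ends(2)[OF eE] finite_Vof[OF F(1)] card_ge_0_finite[of "ends e"] by simp
  moreover have "path_connected (img (insert e F))" unfolding img_ins
    using c pathstart_in_path_image[of c] path_connected_path_image[OF arc_imp_path[OF c(1)]]
    by (intro path_connected_Un F(3)) auto
  moreover have "card (insert e F) = Suc j" using e F finF by simp
  moreover have "finite (components (S2 - img F)) \<and> card (components (S2 - img F)) + card (path_image (\<gamma> e) \<inter> img F)
      \<le> card (components (S2 - img (insert e F))) + 1" if "finite (components (S2 - img (insert e F)))"
    using add_crossing_arc_lower[OF closed_img[OF F(1)] img_S2[OF F(1)] F(3) c(1)] c fin edge(2)[OF eE] that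
    unfolding img_ins by simp
  ultimately show ?case using crossings_insert[OF F(1) e(1)] split IH F(1) eE
    by (intro exI[of _ "insert e F"]) auto
qed

lemma E_nonempty: "E \<noteq> {}"
proof -
  have "V \<noteq> {}" using V3 by auto
  then show ?thesis using exists_edge by blast
qed

lemma drawing_image_eq: "drawing_image V E pos \<gamma> = img E"
proof -
  have "pos v \<in> img E" if "v \<in> V" for v
    using exists_edge[OF that] pos_in_edge_iff[OF _ that] by (auto simp: img_def)
  then show ?thesis by (auto simp: drawing_image_def img_def)
qed

lemma many_cells:
  assumes "finite (components (S2 - img E))"
  shows "card E + card (crossings E) + 2 \<le> card (components (S2 - img E)) + card V"
proof -
  have "1 \<le> card E" using E_nonempty finite_VE by (simp add: Suc_leI card_gt_0_iff)
  then obtain F where F: "F \<subseteq> E" "card F = card E" "finite (components (S2 - img F)) \<longrightarrow>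
    card E + card (crossings F) + 2 \<le> card (components (S2 - img F)) + card (\<Union>(ends ` F))"
    using many_cells_subgraph[of "card E"] by auto
  then have "F = E" using finite_VE card_subset_eq by blast
  moreover have "card (\<Union>(ends ` E)) \<le> card V" using ends(1) finite_VE by (intro card_mono) auto
  ultimately show ?thesis using F(3) assms by simp
qed

end

section \<open>Counting vertex incidences\<close>

text \<open>Double counting: all points of \<open>N p - D\<close> in one sector \<open>Y\<close> lie
  in the same component, so a pair \<open>(p, Y)\<close> is charged to at most one member of the
  family.\<close>

lemma incidence_bound:
  assumes P: "finite P" "\<And>p. p \<in> P \<Longrightarrow> finite (\<Y> p)"
    and join: "\<And>p Y a b. p \<in> P \<Longrightarrow> Y \<in> \<Y> p \<Longrightarrow> a \<in> Y \<inter> (N p - D) \<Longrightarrow> b \<in> Y \<inter> (N p - D) \<Longrightarrow> cc D a b"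
    and F: "finite \<F>" "\<F> \<subseteq> components (S2 - D)"
  shows "(\<Sum>C\<in>\<F>. card {q \<in> Sigma P \<Y>. C \<inter> snd q \<inter> N (fst q) \<noteq> {}}) \<le> (\<Sum>p\<in>P. card (\<Y> p))"
proof -
  let ?Inc = "\<lambda>C. {q \<in> Sigma P \<Y>. C \<inter> snd q \<inter> N (fst q) \<noteq> {}}"
  have fin: "finite (Sigma P \<Y>)" using P by blast
  have dj: "?Inc C \<inter> ?Inc C' = {}" if C: "C \<in> \<F>" "C' \<in> \<F>" "C \<noteq> C'" for C C'
  proof -
    have False if q: "q \<in> ?Inc C" "q \<in> ?Inc C'" for q
    proof -
      obtain a b where ab: "a \<in> C \<inter> snd q \<inter> N (fst q)" "b \<in> C' \<inter> snd q \<inter> N (fst q)" using q by blast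
      moreover have cD: "C \<in> components (S2 - D)" "C' \<in> components (S2 - D)" using C F by blast+
      ultimately have "a \<notin> D" "b \<notin> D" using in_components_subset by blast+
      then have "cc D a b" using join[of "fst q" "snd q" a b] q ab by auto
      then show False using component_eq_if_cc[OF cD] ab C(3) by blast
    qed
    then show ?thesis by blast
  qed
  have "(\<Sum>C\<in>\<F>. card (?Inc C)) = card (\<Union>C\<in>\<F>. ?Inc C)"
    using dj fin F(1) by (intro card_UN_disjoint[symmetric]) (auto intro: finite_subset[OF _ fin])
  also have "\<dots> \<le> card (Sigma P \<Y>)" by (intro card_mono fin) auto
  also have "\<dots> = (\<Sum>p\<in>P. card (\<Y> p))" using P by simp
  finally show ?thesis .
qed

lemma access_near:
  assumes "access_path C v g" "openin (top_of_set S2) N" "v \<in> N" "C \<subseteq> S2"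
  obtains \<delta> where "\<delta> > 0" "\<And>s. s \<in> {0<..min \<delta> 1} \<Longrightarrow> g s \<in> N \<inter> C"
proof -
  obtain T where T: "open T" "N = S2 \<inter> T" using assms(2) by (auto simp: openin_open)
  have g: "continuous_on {0..1} g" "g 0 = v" "g ` {0<..1} \<subseteq> C"
    using assms(1) by (auto simp: access_path_def path_def pathstart_def)
  obtain e where e: "e > 0" "ball v e \<subseteq> T" using T assms(3) open_contains_ball by blast
  obtain \<delta> where d: "\<delta> > 0" "\<And>s. s \<in> {0..1} \<Longrightarrow> dist s 0 < \<delta> \<Longrightarrow> dist (g s) (g 0) < e"
    using g(1) e(1) unfolding continuous_on_iff by (metis atLeastAtMost_iff zero_le_one order_refl)
  have "g s \<in> N \<inter> C" if s: "s \<in> {0<..min (\<delta>/2) 1}" for s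
  proof -
    have "dist s 0 < \<delta>" "s \<in> {0..1}" "s \<in> {0<..1}" using s d(1) by auto
    then have "g s \<in> ball v e" "g s \<in> C" using d(2)[of s] g by (auto simp: dist_commute)
    then show ?thesis using e(2) T assms(4) by blast
  qed
  then show ?thesis using that[of "\<delta>/2"] d(1) by auto
qed

context sphere_drawing begin

text \<open>The neighbourhood \<open>W\<close> is free because \<open>same_access\<close> asks for
  connections inside an arbitrarily small ball. Edges not incident to \<open>v\<close> form a closed
  set that misses \<open>pos v\<close> and plays the part of \<open>Z\<close> in
  \<open>sectors\<close>.\<close>

lemma vertex_sectors:
  assumes v: "v \<in> V" and W: "openin (top_of_set S2) W" "pos v \<in> W"
  shows "\<exists>N \<Y>. openin (top_of_set S2) N \<and> pos v \<in> N \<and> finite \<Y> \<and> card \<Y> \<le> card {e \<in> E. v \<in> ends e} \<and>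
    N - img E \<subseteq> \<Union>\<Y> \<and> (\<forall>Y\<in>\<Y>. \<forall>a\<in>Y \<inter> (N - img E). \<forall>b\<in>Y \<inter> (N - img E). connected_component (W - img E) a b)"
proof -
  define I where "I = {e \<in> E. v \<in> ends e}"
  define \<alpha> where "\<alpha> e = (if pathstart (\<gamma> e) = pos v then \<gamma> e else reversepath (\<gamma> e))" for e
  define Z where "Z = img (E - I)"
  have I: "finite I" "I \<noteq> {}" using finite_VE exists_edge[OF v] by (auto simp: I_def)
  have im: "path_image (\<alpha> e) = path_image (\<gamma> e)" for e by (simp add: \<alpha>_def)
  have arc: "arc (\<alpha> e) \<and> pathstart (\<alpha> e) = pos v \<and> path_image (\<alpha> e) \<subseteq> S2" if e: "e \<in> I" for e
  proof -
    have eE: "e \<in> E" using e by (auto simp: I_def)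
    have "pos v \<in> pos ` ends e" using e by (auto simp: I_def)
    then have "pos v \<in> {pathstart (\<gamma> e), pathfinish (\<gamma> e)}" using edge(3)[OF eE] by simp
    then show ?thesis using edge(1,2)[OF eE] by (auto simp: \<alpha>_def arc_reversepath)
  qed
  have fin: "finite (path_image (\<alpha> e) \<inter> path_image (\<alpha> f))" if "e \<in> I" "f \<in> I" "e \<noteq> f" for e f
    using that finite_inter unfolding im by (auto simp: I_def)
  have Z: "closed Z" unfolding Z_def by (intro closed_img) auto
  have vZ: "pos v \<notin> Z" using pos_in_edge_iff[OF _ v] by (auto simp: Z_def img_def I_def)
  have D: "(\<Union>e\<in>I. path_image (\<alpha> e)) \<subseteq> img E" "img E \<subseteq> (\<Union>e\<in>I. path_image (\<alpha> e)) \<union> Z"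
    unfolding im by (auto simp: img_def I_def Z_def)
  show ?thesis
  proof (rule sectors[OF I arc fin W Z vZ D])
    fix N \<Y> assume "openin (top_of_set S2) N" "pos v \<in> N" "finite \<Y>" "card \<Y> \<le> card I" "N - img E \<subseteq> \<Union>\<Y>"
      "\<And>Y a b. Y \<in> \<Y> \<Longrightarrow> a \<in> Y \<inter> (N - img E) \<Longrightarrow> b \<in> Y \<inter> (N - img E) \<Longrightarrow> connected_component (W - img E) a b"
    then show ?thesis unfolding I_def by blast
  qed
qed

lemma interior_param:
  assumes e: "e \<in> E" and x: "x \<in> path_image (\<gamma> e)" "x \<notin> pos ` V"
  obtains t where "0 < t" "t < 1" "\<gamma> e t = x"
proof -
  obtain t where t: "t \<in> {0..1}" "\<gamma> e t = x" using x by (auto simp: path_image_def)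
  have "\<gamma> e 0 \<in> pos ` ends e" "\<gamma> e 1 \<in> pos ` ends e" using edge(3)[OF e] by (auto simp: pathstart_def pathfinish_def)
  then have "\<gamma> e 0 \<in> pos ` V" "\<gamma> e 1 \<in> pos ` V" using ends(1)[OF e] by blast+
  then have "t \<noteq> 0" "t \<noteq> 1" using t x by auto
  then show ?thesis using that[of t] t by auto
qed

lemma interior_not_pos:
  assumes e: "e \<in> E" and t: "0 < t" "t < 1"
  shows "\<gamma> e t \<notin> pos ` V"
proof
  assume "\<gamma> e t \<in> pos ` V"
  moreover have "\<gamma> e t \<in> path_image (\<gamma> e)" using t by (auto simp: path_image_def)
  ultimately have "\<gamma> e t \<in> {\<gamma> e 0, \<gamma> e 1}" using edge(3,4)[OF e] by (auto simp: pathstart_def pathfinish_def)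
  moreover have "inj_on (\<gamma> e) {0..1}" using edge(1)[OF e] by (simp add: arc_def)
  ultimately show False using t inj_onD[of "\<gamma> e" "{0..1}" t 0] inj_onD[of "\<gamma> e" "{0..1}" t 1] by auto
qed

text \<open>The 4 counts the half-edges at \<open>x\<close>, two from each of the two edges through
  \<open>x\<close>. Any further edge misses \<open>x\<close>, since no three edges share a
  crossing.\<close>

lemma crossing_sectors:
  assumes x: "x \<in> crossings E"
  shows "\<exists>N \<Y>. openin (top_of_set S2) N \<and> x \<in> N \<and> finite \<Y> \<and> card \<Y> \<le> 4 \<and>
    N - img E \<subseteq> \<Union>\<Y> \<and> (\<forall>Y\<in>\<Y>. \<forall>a\<in>Y \<inter> (N - img E). \<forall>b\<in>Y \<inter> (N - img E). cc (img E) a b)"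
proof -
  obtain e f where ef: "e \<in> E" "f \<in> E" "e \<noteq> f" "x \<in> path_image (\<gamma> e)" "x \<in> path_image (\<gamma> f)" "x \<notin> pos ` V"
    using x by (auto simp: crossings_def is_crossing_def)
  define g where "g b = (if b then e else f)" for b
  have g: "g b \<in> E" "x \<in> path_image (\<gamma> (g b))" for b using ef by (auto simp: g_def)
  have "\<exists>t. 0 < t \<and> t < 1 \<and> \<gamma> (g b) t = x" for b using interior_param[OF g ef(6)] by metis
  then obtain t where t: "\<And>b. 0 < t b \<and> t b < 1 \<and> \<gamma> (g b) (t b) = x" by metis
  \<comment> \<open>The index \<open>b\<close> selects the edge, \<open>d\<close> the direction in
    which it is followed from \<open>x\<close>.\<close>
  define \<alpha> where "\<alpha> = (\<lambda>(b, d). subpath (t b) (if d then 1 else 0) (\<gamma> (g b)))"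
  define Z where "Z = img (E - {e, f})"
  have im: "path_image (\<alpha> (b, d)) = \<gamma> (g b) ` (if d then {t b..1} else {0..t b})" for b d
    using t[of b] by (auto simp: \<alpha>_def path_image_subpath)
  have sub: "path_image (\<alpha> (b, d)) \<subseteq> path_image (\<gamma> (g b))" for b d
    unfolding im using t[of b] by (auto simp: path_image_def)
  have arc: "arc (\<alpha> i) \<and> pathstart (\<alpha> i) = x \<and> path_image (\<alpha> i) \<subseteq> S2" for i
  proof (cases i)
    case (Pair b d)
    have "arc (\<alpha> (b, d))" using t[of b] by (auto simp: \<alpha>_def intro!: arc_subpath_arc[OF edge(1)[OF g(1)]])
    moreover have "pathstart (\<alpha> (b, d)) = x" using t[of b] by (simp add: \<alpha>_def)
    ultimately show ?thesis using sub[of b d] edge(2)[OF g(1), of b] Pair by auto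
  qed
  have fin: "finite (path_image (\<alpha> i) \<inter> path_image (\<alpha> j))" if "i \<noteq> j" for i j
  proof -
    obtain b d b' d' where i: "i = (b, d)" "j = (b', d')" by fastforce
    show ?thesis
    proof (cases "b = b'")
      case False
      then have "g b \<noteq> g b'" using ef by (auto simp: g_def)
      then have "finite (path_image (\<gamma> (g b)) \<inter> path_image (\<gamma> (g b')))" using finite_inter g by blast
      then show ?thesis using i sub[of b d] sub[of b' d'] by (elim finite_subset[rotated]) blast
    next
      case True
      have "inj_on (\<gamma> (g b)) {0..1}" using edge(1)[OF g(1)] by (simp add: arc_def)
      then have "\<gamma> (g b) ` {t b..1} \<inter> \<gamma> (g b) ` {0..t b} = \<gamma> (g b) ` ({t b..1} \<inter> {0..t b})"
        using t[of b] by (intro inj_on_image_Int[symmetric]) auto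
      also have "{t b..1} \<inter> {0..t b} = {t b}" using t[of b] by auto
      finally have "finite (\<gamma> (g b) ` {t b..1} \<inter> \<gamma> (g b) ` {0..t b})" by simp
      moreover have "d \<noteq> d'" using that i True by auto
      ultimately show ?thesis unfolding i im True by (cases d; cases d') (auto simp: Int_commute)
    qed
  qed
  have Z: "closed Z" unfolding Z_def by (intro closed_img) auto
  have xZ: "x \<notin> Z"
  proof
    assume "x \<in> Z"
    then obtain h where "h \<in> E" "h \<noteq> e" "h \<noteq> f" "x \<in> path_image (\<gamma> h)" by (auto simp: Z_def img_def)
    then show False using no_triple[of e f h] ef by blast
  qed
  have full: "path_image (\<gamma> (g b)) = path_image (\<alpha> (b, True)) \<union> path_image (\<alpha> (b, False))" for b
  proof -
    have "{0..1} = {t b..1} \<union> {0..t b}" using t[of b] by auto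
    then show ?thesis unfolding im path_image_def[of "\<gamma> (g b)"] by (metis image_Un)
  qed
  have "path_image (\<gamma> h) \<subseteq> (\<Union>i. path_image (\<alpha> i)) \<union> Z" if h: "h \<in> E" for h
  proof (cases "h = e \<or> h = f")
    case True
    then obtain b where "h = g b" unfolding g_def by metis
    then show ?thesis using full[of b] by blast
  qed (use h in \<open>auto simp: Z_def img_def\<close>)
  then have D2: "img E \<subseteq> (\<Union>i. path_image (\<alpha> i)) \<union> Z" unfolding img_def by blast
  have D1: "(\<Union>i. path_image (\<alpha> i)) \<subseteq> img E" using sub g by (fastforce simp: img_def)
  have xS: "x \<in> S2" using ef edge(2) by blast
  obtain N \<Y> where "openin (top_of_set S2) N" "x \<in> N" "finite \<Y>" "card \<Y> \<le> card (UNIV :: (bool \<times> bool) set)" "N - img E \<subseteq> \<Union>\<Y>"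
    "\<And>Y a b. Y \<in> \<Y> \<Longrightarrow> a \<in> Y \<inter> (N - img E) \<Longrightarrow> b \<in> Y \<inter> (N - img E) \<Longrightarrow> cc (img E) a b"
    by (rule sectors[of UNIV \<alpha> x S2 Z "img E", OF _ _ arc fin _ xS Z xZ D1 D2]) (simp_all add: that)
  moreover have "card (UNIV :: (bool \<times> bool) set) = 4" by (simp add: card_UNIV_bool flip: UNIV_Times_UNIV)
  ultimately show ?thesis by (intro exI[of _ N] exI[of _ \<Y>]) auto
qed

lemma sum_degrees: "(\<Sum>v\<in>V. card {e \<in> E. v \<in> ends e}) = 2 * card E"
proof -
  have "(\<Sum>v\<in>V. card {e \<in> E. v \<in> ends e}) = (\<Sum>v\<in>V. \<Sum>e\<in>E. if v \<in> ends e then 1 else (0::nat))"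
    using finite_VE by (simp add: sum.If_cases Int_def)
  also have "\<dots> = (\<Sum>e\<in>E. \<Sum>v\<in>V. if v \<in> ends e then 1 else 0)" by (rule sum.swap)
  also have "\<dots> = (\<Sum>e\<in>E. 2)"
  proof (rule sum.cong)
    fix e assume e: "e \<in> E"
    then have "V \<inter> {v. v \<in> ends e} = ends e" using ends by blast
    then show "(\<Sum>v\<in>V. if v \<in> ends e then 1 else (0::nat)) = 2"
      using finite_VE ends(2)[OF e] by (simp add: sum.If_cases)
  qed simp
  finally show ?thesis by simp
qed

text \<open>A cell with the crossing \<open>x\<close> in its closure has points in every
  neighbourhood of \<open>x\<close>, hence in one of the at most four sectors there, and no sector
  serves two cells.\<close>

lemma crossing_cells:
  assumes F: "finite \<F>" "\<F> \<subseteq> components (S2 - img E)"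
    and cr: "\<And>C. C \<in> \<F> \<Longrightarrow> closure C \<inter> crossings E \<noteq> {}"
  shows "card \<F> \<le> 4 * card (crossings E)"
proof -
  obtain N \<Y> where NY: "\<And>x. x \<in> crossings E \<Longrightarrow> openin (top_of_set S2) (N x) \<and> x \<in> N x \<and> finite (\<Y> x) \<and> card (\<Y> x) \<le> 4 \<and>
    N x - img E \<subseteq> \<Union>(\<Y> x) \<and> (\<forall>Y\<in>\<Y> x. \<forall>a\<in>Y \<inter> (N x - img E). \<forall>b\<in>Y \<inter> (N x - img E). cc (img E) a b)"
    using crossing_sectors by metis
  let ?Inc = "\<lambda>C. {q \<in> Sigma (crossings E) \<Y>. C \<inter> snd q \<inter> N (fst q) \<noteq> {}}"
  have fin: "finite (Sigma (crossings E) \<Y>)" using NY finite_crossings by blast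
  have "1 \<le> card (?Inc C)" if C: "C \<in> \<F>" for C
  proof -
    obtain x where x: "x \<in> closure C" "x \<in> crossings E" using cr[OF C] by blast
    obtain T where T: "open T" "N x = S2 \<inter> T" using NY[OF x(2)] by (auto simp: openin_open)
    have CS: "C \<subseteq> S2 - img E" using C F in_components_subset by blast
    have "x \<in> T" using NY[OF x(2)] T by blast
    then obtain y where y: "y \<in> C" "y \<in> T" using x(1) T(1)
      by (metis closure_iff_nhds_not_empty disjoint_iff order_refl)
    then have "y \<in> N x - img E" using CS T by blast
    then obtain Y where "Y \<in> \<Y> x" "y \<in> Y" using NY[OF x(2)] by blast
    then have "(x, Y) \<in> ?Inc C" using x y \<open>y \<in> N x - img E\<close> by auto
    moreover have "finite (?Inc C)" by (rule finite_subset[OF _ fin]) blast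
    ultimately have "0 < card (?Inc C)" using card_gt_0_iff[of "?Inc C"] by blast
    then show ?thesis by simp
  qed
  then have "card \<F> \<le> (\<Sum>C\<in>\<F>. card (?Inc C))" using sum_mono[of \<F> "\<lambda>_. 1::nat"] by simp
  also have "\<dots> \<le> (\<Sum>x\<in>crossings E. card (\<Y> x))"
    using incidence_bound[of "crossings E" \<Y> N "img E" \<F>] finite_crossings NY F by blast
  also have "\<dots> \<le> (\<Sum>x\<in>crossings E. 4)" using NY by (intro sum_mono) blast
  finally show ?thesis by simp
qed

text \<open>A cell receives one sector at each vertex in its closure, and also two different sectors
  from its two accesses, so it is charged the larger number. The sectors at \<open>v\<close> number
  at most the degree of \<open>v\<close>, and the degrees sum to \<open>2 * card E\<close>.\<close>

lemma vertex_incidences: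
  assumes F: "finite \<F>" "\<F> \<subseteq> components (S2 - img E)"
    and two: "\<And>C. C \<in> \<F> \<Longrightarrow> at_least_k_incidences 2 V pos C"
  shows "(\<Sum>C\<in>\<F>. max 2 (card {v \<in> V. pos v \<in> closure C})) \<le> 2 * card E"
proof -
  \<comment> \<open>Two accesses at the same vertex stay apart within a ball whose radius depends on
    the cell. \<open>good\<close> fixes the radius and is inherited by smaller ones, so the minimum
    over the finite family serves all cells, and the neighbourhoods \<open>W v\<close> can be chosen
    independently of the cell.\<close>
  define good where "good C \<epsilon> \<longleftrightarrow> (\<exists>w0\<in>V. \<exists>w1\<in>V. \<exists>g0 g1. access_path C (pos w0) g0 \<and> access_path C (pos w1) g1 \<and>
    (w0 = w1 \<longrightarrow> (\<exists>\<delta>>0. \<forall>s\<in>{0<..min \<delta> 1}. \<forall>t\<in>{0<..min \<delta> 1}. \<forall>p.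
       path p \<longrightarrow> pathstart p = g0 s \<longrightarrow> pathfinish p = g1 t \<longrightarrow> \<not> path_image p \<subseteq> C \<inter> ball (pos w0) \<epsilon>)))"
    for C \<epsilon>
  have mono: "good C \<epsilon>'" if "good C \<epsilon>" "\<epsilon>' \<le> \<epsilon>" for C \<epsilon> \<epsilon>'
  proof -
    have "ball y \<epsilon>' \<subseteq> ball y \<epsilon>" for y :: pt using that(2) by (rule subset_ball)
    then show ?thesis using that(1) unfolding good_def by (meson Int_mono order_refl order_trans)
  qed
  have ex: "\<exists>\<epsilon>>0. good C \<epsilon>" if C: "C \<in> \<F>" for C
  proof -
    obtain w g where w: "\<forall>i<(2::nat). w i \<in> V \<and> access_path C (pos (w i)) (g i)"
      and ns: "\<forall>i<(2::nat). \<forall>j<(2::nat). i \<noteq> j \<longrightarrow> w i = w j \<longrightarrow> \<not> same_access C (pos (w i)) (g i) (g j)"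
      using two[OF C] unfolding at_least_k_incidences_def by (elim exE conjE)
    have w01: "w 0 \<in> V" "w 1 \<in> V" "access_path C (pos (w 0)) (g 0)" "access_path C (pos (w 1)) (g 1)"
      using w[rule_format, of 0] w[rule_format, of 1] by auto
    show ?thesis
    proof (cases "w 0 = w 1")
      case True
      then have "\<not> same_access C (pos (w 0)) (g 0) (g 1)" using ns[rule_format, of 0 1] by auto
      then obtain \<epsilon> where "\<epsilon> > 0" and "\<exists>\<delta>>0. \<forall>s\<in>{0<..min \<delta> 1}. \<forall>t\<in>{0<..min \<delta> 1}. \<forall>p.
         path p \<longrightarrow> pathstart p = g 0 s \<longrightarrow> pathfinish p = g 1 t \<longrightarrow> \<not> path_image p \<subseteq> C \<inter> ball (pos (w 0)) \<epsilon>"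
        unfolding same_access_def by meson
      then have "good C \<epsilon>" unfolding good_def using w01 by blast
      then show ?thesis using \<open>\<epsilon> > 0\<close> by blast
    next
      case False
      then have "good C 1" unfolding good_def using w01 by blast
      then show ?thesis using zero_less_one by blast
    qed
  qed
  obtain \<epsilon>0 where \<epsilon>0: "\<And>C. C \<in> \<F> \<Longrightarrow> \<epsilon>0 C > 0 \<and> good C (\<epsilon>0 C)" using ex by metis
  define \<epsilon> where "\<epsilon> = Min (insert 1 (\<epsilon>0 ` \<F>))"
  have "\<epsilon> > 0" unfolding \<epsilon>_def using \<epsilon>0 F(1) by auto
  have good: "good C \<epsilon>" if "C \<in> \<F>" for C
    using mono[of C "\<epsilon>0 C"] \<epsilon>0[OF that] F(1) that by (simp add: \<epsilon>_def)
  define W where "W v = S2 \<inter> ball (pos v) \<epsilon>" for v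
  have W: "openin (top_of_set S2) (W v)" "v \<in> V \<Longrightarrow> pos v \<in> W v" for v
    using pos_S2 \<open>\<epsilon> > 0\<close> by (auto simp: W_def)
  define R where "R v N \<Y> \<longleftrightarrow> openin (top_of_set S2) N \<and> pos v \<in> N \<and> finite \<Y> \<and> card \<Y> \<le> card {e \<in> E. v \<in> ends e} \<and>
    N - img E \<subseteq> \<Union>\<Y> \<and> (\<forall>Y\<in>\<Y>. \<forall>a\<in>Y \<inter> (N - img E). \<forall>b\<in>Y \<inter> (N - img E). connected_component (W v - img E) a b)"
    for v N and \<Y> :: "pt set set"
  have "\<forall>v\<in>V. \<exists>N \<Y>. R v N \<Y>"
    unfolding R_def using vertex_sectors W by blast
  then obtain N \<Y> where NY: "\<forall>v\<in>V. R v (N v) (\<Y> v)" by metis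
  have N: "openin (top_of_set S2) (N v)" "pos v \<in> N v" and Y: "finite (\<Y> v)" "card (\<Y> v) \<le> card {e \<in> E. v \<in> ends e}" 
    and cov: "N v - img E \<subseteq> \<Union>(\<Y> v)" if "v \<in> V" for v
    using NY that unfolding R_def by auto
  have join: "connected_component (W v - img E) a b" 
    if "v \<in> V" "Q \<in> \<Y> v" "a \<in> Q \<inter> (N v - img E)" "b \<in> Q \<inter> (N v - img E)" for v Q a b
    using NY that unfolding R_def by blast
  let ?Inc = "\<lambda>C. {q \<in> Sigma V \<Y>. C \<inter> snd q \<inter> N (fst q) \<noteq> {}}"
  have fin: "finite (Sigma V \<Y>)" using Y finite_VE by blast
  have finI: "finite (?Inc C)" for C by (rule finite_subset[OF _ fin]) blast
  have "max 2 (card {v \<in> V. pos v \<in> closure C}) \<le> card (?Inc C)" if C: "C \<in> \<F>" for C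
  proof -
    have Cc: "C \<in> components (S2 - img E)" using C F by blast
    have CS: "C \<subseteq> S2 - img E" using in_components_subset[OF Cc] .
    have "{v \<in> V. pos v \<in> closure C} \<subseteq> fst ` ?Inc C"
    proof
      fix v assume v: "v \<in> {v \<in> V. pos v \<in> closure C}"
      then obtain T where T: "open T" "N v = S2 \<inter> T" using N(1)[of v] by (auto simp: openin_open)
      have "pos v \<in> T" using N(2)[of v] v T by blast
      then obtain y where y: "y \<in> C" "y \<in> T" using v T(1)
        by (metis (no_types, lifting) closure_iff_nhds_not_empty disjoint_iff mem_Collect_eq order_refl)
      then have "y \<in> N v - img E" using CS T by blast
      then obtain Q where "Q \<in> \<Y> v" "y \<in> Q" using cov v by blast
      then have "(v, Q) \<in> ?Inc C" using v y \<open>y \<in> N v - img E\<close> by auto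
      then show "v \<in> fst ` ?Inc C" by force
    qed
    then have 1: "card {v \<in> V. pos v \<in> closure C} \<le> card (?Inc C)" using finI surj_card_le by blast
    obtain w0 w1 g0 g1 where w: "w0 \<in> V" "w1 \<in> V" and g: "access_path C (pos w0) g0" "access_path C (pos w1) g1"
      and ne: "w0 = w1 \<Longrightarrow> \<exists>\<delta>>0. \<forall>s\<in>{0<..min \<delta> 1}. \<forall>t\<in>{0<..min \<delta> 1}. \<forall>p.
       path p \<longrightarrow> pathstart p = g0 s \<longrightarrow> pathfinish p = g1 t \<longrightarrow> \<not> path_image p \<subseteq> C \<inter> ball (pos w0) \<epsilon>"
      using good[OF C] unfolding good_def by blast
    have CS2: "C \<subseteq> S2" using CS by blast
    obtain \<delta>0 where d0: "\<delta>0 > 0" "\<And>s. s \<in> {0<..min \<delta>0 1} \<Longrightarrow> g0 s \<in> N w0 \<inter> C"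
      using access_near[OF g(1) N(1)[OF w(1)] N(2)[OF w(1)] CS2] by blast
    obtain \<delta>1 where d1: "\<delta>1 > 0" "\<And>s. s \<in> {0<..min \<delta>1 1} \<Longrightarrow> g1 s \<in> N w1 \<inter> C"
      using access_near[OF g(2) N(1)[OF w(2)] N(2)[OF w(2)] CS2] by blast
    \<comment> \<open>Were there only one sector, both accesses would start at one vertex and lie in
      that sector for small parameters. A path inside the ball and off the drawing, hence inside
      \<open>C\<close>, would then join them.\<close>
    have "\<exists>q0\<in>?Inc C. \<exists>q1\<in>?Inc C. q0 \<noteq> q1"
    proof (rule ccontr)
      assume H: "\<not> ?thesis"
      obtain \<delta>2 where d2: "\<delta>2 > 0" "w0 = w1 \<Longrightarrow> \<forall>s\<in>{0<..min \<delta>2 1}. \<forall>t\<in>{0<..min \<delta>2 1}. \<forall>p.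
       path p \<longrightarrow> pathstart p = g0 s \<longrightarrow> pathfinish p = g1 t \<longrightarrow> \<not> path_image p \<subseteq> C \<inter> ball (pos w0) \<epsilon>"
        using ne zero_less_one by metis
      define s where "s = min (min \<delta>0 \<delta>1) (min \<delta>2 1)"
      have s: "s \<in> {0<..min \<delta>0 1}" "s \<in> {0<..min \<delta>1 1}" "s \<in> {0<..min \<delta>2 1}"
        using d0(1) d1(1) d2(1) by (auto simp: s_def)
      have gs: "g0 s \<in> N w0 - img E" "g1 s \<in> N w1 - img E" "g0 s \<in> C" "g1 s \<in> C"
        using d0(2)[OF s(1)] d1(2)[OF s(2)] CS by blast+
      obtain Q0 where Q0: "Q0 \<in> \<Y> w0" "g0 s \<in> Q0" using cov[OF w(1)] gs(1) by blast
      obtain Q1 where Q1: "Q1 \<in> \<Y> w1" "g1 s \<in> Q1" using cov[OF w(2)] gs(2) by blast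
      have "(w0, Q0) \<in> ?Inc C" "(w1, Q1) \<in> ?Inc C" using Q0 Q1 gs w by auto
      then have eq: "w0 = w1" "Q0 = Q1" using H by blast+
      have "connected_component (W w0 - img E) (g0 s) (g1 s)"
        using join[OF w(1) Q0(1)] Q0 Q1 gs eq by blast
      moreover have "openin (top_of_set S2) (W w0 - img E)"
        using W(1) closed_img[of E] by (metis order_refl openin_diff closed_subset closedin_closed_Int img_S2 inf.absorb_iff2)
      then have "locally path_connected (W w0 - img E)"
        using locally_open_subset[OF locally_path_connected_sphere] by blast
      ultimately have "path_component (W w0 - img E) (g0 s) (g1 s)"
        by (simp add: path_component_eq_connected_component)
      then obtain p where p: "path p" "path_image p \<subseteq> W w0 - img E" "pathstart p = g0 s" "pathfinish p = g1 s"
        unfolding path_component_def by blast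
      have "path_image p \<subseteq> C"
        by (rule components_maximal[OF Cc]) (use p gs pathstart_in_path_image[of p] in \<open>auto simp: W_def connected_path_image\<close>)
      then have "path_image p \<subseteq> C \<inter> ball (pos w0) \<epsilon>" using p(2) by (auto simp: W_def)
      then show False using d2(2)[OF eq(1)] s(3) p by blast
    qed
    then obtain q0 q1 where q: "{q0, q1} \<subseteq> ?Inc C" "q0 \<noteq> q1" by blast
    then have "2 \<le> card (?Inc C)" using card_mono[OF finI q(1)] by simp
    then show ?thesis using 1 by simp
  qed
  then have "(\<Sum>C\<in>\<F>. max 2 (card {v \<in> V. pos v \<in> closure C})) \<le> (\<Sum>C\<in>\<F>. card (?Inc C))" by (rule sum_mono)
  also have "\<dots> \<le> (\<Sum>v\<in>V. card (\<Y> v))"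
  proof (rule incidence_bound[OF finite_VE(1) Y(1) _ F])
    fix v Q a b assume "v \<in> V" "Q \<in> \<Y> v" "a \<in> Q \<inter> (N v - img E)" "b \<in> Q \<inter> (N v - img E)"
    then have "connected_component (W v - img E) a b" by (rule join)
    then show "cc (img E) a b" by (rule connected_component_of_subset) (auto simp: W_def)
  qed
  also have "\<dots> \<le> (\<Sum>v\<in>V. card {e \<in> E. v \<in> ends e})" using Y(2) by (rule sum_mono)
  finally show ?thesis using sum_degrees by simp
qed

end

section \<open>Cells without crossings on the boundary\<close>

lemma closure_component_Int:
  assumes "C \<in> components X" shows "closure C \<inter> X \<subseteq> C"
proof -
  have "closedin (top_of_set X) C" using assms by (rule closedin_component)
  then obtain T where "closed T" "C = X \<inter> T" by (auto simp: closedin_closed)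
  then show ?thesis using closure_minimal[of C T] by blast
qed

text \<open>The side \<open>B\<close> of \<open>c1 \<union> c2\<close> that avoids \<open>C\<close> is joined to \<open>C\<close> through the interior of \<open>c2\<close> without
  meeting \<open>c1 \<union> c3\<close>, and through the interior of \<open>c1\<close> without meeting \<open>c2 \<union> c3\<close>. These two sets meet in
  the connected set \<open>c3\<close>, so Janiszewski's theorem joins \<open>B\<close> and \<open>C\<close> off \<open>c1 \<union> c2\<close>.\<close>
lemma theta_component:
  assumes arcs: "arc c1" "arc c2" "arc c3" and sub: "path_image c1 \<subseteq> S2" "path_image c2 \<subseteq> S2" "path_image c3 \<subseteq> S2"
    and ends: "{pathstart c1, pathfinish c1} = P" "{pathstart c2, pathfinish c2} = P" "{pathstart c3, pathfinish c3} = P"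
    and int: "path_image c1 \<inter> path_image c2 = P" "path_image c1 \<inter> path_image c3 = P" "path_image c2 \<inter> path_image c3 = P"
    and C: "connected C" "C \<noteq> {}" "C \<subseteq> S2 - (path_image c1 \<union> path_image c2 \<union> path_image c3)"
    and cl: "path_image c1 \<subseteq> closure C" "path_image c2 \<subseteq> closure C" "path_image c3 \<subseteq> closure C"
  shows False
proof -
  define J where "J = path_image c1 \<union> path_image c2"
  obtain A' B' where AB': "A' \<noteq> B'" "components (S2 - J) = {A', B'}" "J \<subseteq> closure A'" "J \<subseteq> closure B'"
    unfolding J_def
  proof (rule Jordan_S2[OF arcs(1,2) sub(1,2)])
    show "{pathstart c1, pathfinish c1} = {pathstart c2, pathfinish c2}" using ends by simp
    show "path_image c1 \<inter> path_image c2 = {pathstart c1, pathfinish c1}" using ends int by simp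
  qed
  obtain A where A: "A \<in> components (S2 - J)" "C \<subseteq> A"
    using exists_component_superset[of C "S2 - J"] C unfolding J_def by blast
  obtain B where B: "B \<in> components (S2 - J)" "B \<noteq> A" "J \<subseteq> closure B"
    using A AB' by (metis insertCI)
  have BS: "B \<subseteq> S2 - J" "connected B" "B \<noteq> {}" "A \<inter> B = {}"
    using B in_components_subset in_components_connected in_components_nonempty components_eq[OF A(1) B(1)] by blast+
  \<comment> \<open>The interior of \<open>c3\<close> avoids \<open>J\<close> and lies in the
    closure of \<open>C\<close>, so it is on the side \<open>A\<close> of \<open>C\<close>. The
    other side \<open>B\<close> is therefore disjoint from \<open>c3\<close>.\<close>
  have "path_image c3 - P \<subseteq> S2 - J" using int sub(3) unfolding J_def by blast
  then have "path_image c3 - P \<subseteq> A" using cl(3) closure_mono[OF A(2)] closure_component_Int[OF A(1)] by blast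
  moreover have "P \<subseteq> J" using int unfolding J_def by blast
  ultimately have B3: "B \<inter> path_image c3 = {}" using BS by blast
  obtain b c where b: "b \<in> B" and c: "c \<in> C" using BS C by blast
  have link: "cc (path_image d \<union> path_image c3) b c"
    if d: "path_image d \<inter> path_image f = P" "path_image f \<inter> path_image c3 = P" "arc f" "{pathstart f, pathfinish f} = P"
      "path_image f \<subseteq> S2" "path_image f \<subseteq> J" "path_image d \<subseteq> J" "path_image f \<subseteq> closure C"
      "C \<inter> path_image d = {}" for d f
  proof -
    define I where "I = path_image f - P"
    have I: "connected I" "I \<noteq> {}" 
      unfolding I_def d(4)[symmetric] using d(3) arc_imp_simple_path connected_simple_path_endless nonempty_simple_path_endless by blast+
    have "I \<subseteq> closure B" "I \<subseteq> closure C" using d B(3) by (auto simp: I_def)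
    have "connected (B \<union> I)"
      by (rule connected_intermediate_closure[OF BS(2)]) (use \<open>I \<subseteq> closure B\<close> closure_subset in auto)
    moreover have "connected (C \<union> I)"
      by (rule connected_intermediate_closure[OF C(1)]) (use \<open>I \<subseteq> closure C\<close> closure_subset in auto)
    ultimately have "connected ((B \<union> I) \<union> (C \<union> I))" by (rule connected_Un) (use I(2) in blast)
    moreover have "(B \<union> I) \<union> (C \<union> I) \<subseteq> S2 - (path_image d \<union> path_image c3)"
      using B3 BS(1) d C(3) by (auto simp: I_def)
    ultimately show ?thesis unfolding connected_component_def using b c by blast
  qed
  have C0: "C \<inter> path_image c1 = {}" "C \<inter> path_image c2 = {}" using C(3) by blast+
  have l1: "cc (path_image c1 \<union> path_image c3) b c"
    using link[of c1 c2] int ends arcs sub cl C0 by (auto simp: J_def)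
  have l2: "cc (path_image c2 \<union> path_image c3) b c"
    using link[of c2 c1] int ends arcs sub cl C0 by (auto simp: J_def)
  have "(path_image c1 \<union> path_image c3) \<inter> (path_image c2 \<union> path_image c3) = path_image c3"
    using int by blast
  then have con: "connected ((path_image c1 \<union> path_image c3) \<inter> (path_image c2 \<union> path_image c3))"
    using arcs(3) connected_arc_image by simp
  have cls: "closed (path_image c1 \<union> path_image c3)" "closed (path_image c2 \<union> path_image c3)"
    using arcs by (auto intro!: closed_Un closed_arc_image)
  have "cc ((path_image c1 \<union> path_image c3) \<union> (path_image c2 \<union> path_image c3)) b c"
    by (rule Janiszewski_S2[OF cls(1) _ cls(2) _ con l1 l2]) (use sub in auto)
  then have "cc J b c" by (rule connected_component_of_subset) (auto simp: J_def)
  then show False using component_eq_if_cc[OF B(1) A(1) b] A(2) B(2) c by blast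
qed

context sphere_drawing begin

text \<open>The inner parameters of \<open>e\<close> that are mapped into the closure of
  \<open>C\<close> form a clopen subset of the open unit interval. Openness is
  \<open>arc_local_closure\<close>: without a crossing in the closure of \<open>C\<close>, the other
  edges keep away from such a point.\<close>

lemma edge_in_closure:
  assumes C: "C \<in> components (S2 - img E)" "closure C \<inter> crossings E = {}"
    and e: "e \<in> E" and x: "x \<in> path_image (\<gamma> e)" "x \<notin> pos ` V" "x \<in> closure C"
  shows "path_image (\<gamma> e) \<subseteq> closure C"
proof -
  define T where "T = {t \<in> {0<..<1}. \<gamma> e t \<in> closure C}"
  have cont: "continuous_on {0..1} (\<gamma> e)" using edge(1)[OF e] by (auto simp: arc_def path_def)
  then have cont': "continuous_on {0<..<1} (\<gamma> e)" by (rule continuous_on_subset) auto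
  obtain t0 where "0 < t0" "t0 < 1" "\<gamma> e t0 = x" using interior_param[OF e x(1,2)] .
  then have "T \<noteq> {}" using x(3) by (auto simp: T_def)
  moreover have "closedin (top_of_set {0<..<1}) T"
  proof -
    have "T = {0<..<1} \<inter> \<gamma> e -` closure C" by (auto simp: T_def)
    then show ?thesis using continuous_closedin_preimage[OF cont' closed_closure] by simp
  qed
  moreover have "openin (top_of_set {0<..<1}) T"
  proof (subst openin_subopen, intro ballI)
    fix t assume "t \<in> T"
    then have t: "0 < t" "t < 1" "\<gamma> e t \<in> closure C" by (auto simp: T_def)
    define Z where "Z = img (E - {e})"
    have Z: "closed Z" unfolding Z_def by (intro closed_img) auto
    have "\<gamma> e t \<in> path_image (\<gamma> e)" using t by (auto simp: path_image_def)
    then have tZ: "\<gamma> e t \<notin> Z"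
      using C(2) t(3) e interior_not_pos[OF e t(1,2)] by (auto simp: Z_def img_def crossings_def is_crossing_def)
    have D: "path_image (\<gamma> e) \<subseteq> img E" "img E \<subseteq> path_image (\<gamma> e) \<union> Z" using e by (auto simp: img_def Z_def)
    obtain N where N: "openin (top_of_set S2) N" "\<gamma> e t \<in> N" "N \<inter> path_image (\<gamma> e) \<subseteq> closure C"
      by (rule arc_local_closure[OF edge(1,2)[OF e] t(1,2) Z tZ D C(1) t(3)])
    obtain U where U: "open U" "N = S2 \<inter> U" using N(1) by (auto simp: openin_open)
    have "openin (top_of_set {0<..<1}) ({0<..<1} \<inter> \<gamma> e -` U)"
      using continuous_openin_preimage_gen[OF cont' U(1)] .
    moreover have "{0<..<1} \<inter> \<gamma> e -` U \<subseteq> T"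
    proof
      fix s assume s: "s \<in> {0<..<1} \<inter> \<gamma> e -` U"
      then have "\<gamma> e s \<in> path_image (\<gamma> e)" by (auto simp: path_image_def)
      moreover from this have "\<gamma> e s \<in> N" using s U edge(2)[OF e] by auto
      ultimately show "s \<in> T" using N(3) s by (auto simp: T_def)
    qed
    moreover have "t \<in> {0<..<1} \<inter> \<gamma> e -` U" using t N(2) U by auto
    ultimately show "\<exists>S. openin (top_of_set {0<..<1}) S \<and> t \<in> S \<and> S \<subseteq> T" by blast
  qed
  ultimately have "T = {0<..<1}" using connected_clopen[of "{0<..<1::real}"] by auto
  then have "\<gamma> e ` {0<..<1} \<subseteq> closure C" by (auto simp: T_def)
  moreover have "\<gamma> e ` closure {0<..<1} \<subseteq> closure (\<gamma> e ` {0<..<1})"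
    by (rule image_closure_subset) (use cont in \<open>simp_all add: closure_subset\<close>)
  moreover have "closure {0<..<1::real} = {0..1}" by simp
  ultimately have "\<gamma> e ` {0..1} \<subseteq> closure C" using closure_minimal[OF _ closed_closure] by (metis order_trans)
  then show ?thesis by (simp add: path_image_def)
qed

text \<open>Erasing edges that \<open>C\<close> does not border must not enlarge \<open>C\<close>.
  The only danger is a vertex \<open>y\<close> in the closure of \<open>C\<close> where just erased
  edges end. A small punctured disc around \<open>y\<close> is connected, and \<open>C\<close> is
  clopen in it, so it lies in \<open>C\<close>; but an edge at \<open>y\<close> has further points
  in that disc.\<close>

lemma component_of_boundary_edges:
  assumes C: "C \<in> components (S2 - img E)"
    and F: "F \<subseteq> E" "\<And>e x. e \<in> E \<Longrightarrow> x \<in> path_image (\<gamma> e) \<Longrightarrow> x \<notin> pos ` V \<Longrightarrow> x \<in> closure C \<Longrightarrow> e \<in> F"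
  shows "C \<in> components (S2 - img F)"
proof -
  have Cp: "connected C" "C \<noteq> {}" "C \<subseteq> S2 - img E"
    using C in_components_connected in_components_nonempty in_components_subset by blast+
  have FE: "img F \<subseteq> img E" using F(1) by (auto simp: img_def)
  have key: "y \<in> C" if y: "y \<in> closure C" "y \<in> S2 - img F" for y
  proof (rule ccontr)
    assume nC: "y \<notin> C"
    then have "y \<in> img E" using closure_component_Int[OF C] y by blast
    then obtain e where e: "e \<in> E" "y \<in> path_image (\<gamma> e)" by (auto simp: img_def)
    then have "y \<in> pos ` V" using F(2)[of e y] y by (auto simp: img_def)
    define W where "W = S2 - (img F \<union> (pos ` V - {y}))"
    have "closed (pos ` V - {y})" using finite_VE(1) by (intro finite_imp_closed) simp
    then have "openin (top_of_set S2) W" unfolding W_def by (intro openin_S2_compl closed_Un closed_img[OF F(1)])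
    moreover have "y \<in> W" using y by (auto simp: W_def)
    ultimately obtain K where K: "compact K" "K \<subseteq> S2" "y \<notin> K" "S2 - W \<subseteq> K" "connected (S2 - K)" "connected (S2 - K - {y})"
      using disc_nbhd by metis
    define U where "U = S2 - K"
    have U: "openin (top_of_set S2) U" unfolding U_def by (rule openin_S2_compl) (use K compact_imp_closed in blast)
    have UW: "U \<subseteq> W" using K by (auto simp: U_def)
    have yU: "y \<in> U" using y K by (auto simp: U_def)
    obtain T where T: "open T" "U = S2 \<inter> T" using U by (auto simp: openin_open)
    have clC: "closure C \<inter> (U - {y}) \<subseteq> C"
    proof
      fix z assume z: "z \<in> closure C \<inter> (U - {y})"
      show "z \<in> C"
      proof (cases "z \<in> img E")
        case True
        then obtain f where f: "f \<in> E" "z \<in> path_image (\<gamma> f)" by (auto simp: img_def)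
        have "z \<notin> img F" "z \<notin> pos ` V" using z UW by (auto simp: W_def)
        then have False using F(2)[OF f] z f by (auto simp: img_def)
        then show ?thesis ..
      next
        case False
        then show ?thesis using closure_component_Int[OF C] z UW by (auto simp: W_def)
      qed
    qed
    obtain z where z: "z \<in> C" "z \<in> T" 
      using y(1) T yU by (metis IntD2 closure_iff_nhds_not_empty disjoint_iff order_refl)
    have zU: "z \<in> C \<inter> (U - {y})" using z T Cp(3) nC by blast
    have opC: "openin (top_of_set S2) C" using openin_component_S2[OF openin_S2_compl[OF closed_img[OF order_refl]] C] .
    have "openin (top_of_set (U - {y})) (C \<inter> (U - {y}))"
    proof -
      obtain S where "open S" "C = S2 \<inter> S" using opC by (auto simp: openin_open)
      then have "C \<inter> (U - {y}) = (U - {y}) \<inter> S" using T by blast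
      then show ?thesis using \<open>open S\<close> by (auto simp: openin_open)
    qed
    moreover have "closedin (top_of_set (U - {y})) (C \<inter> (U - {y}))"
    proof -
      have "C \<inter> (U - {y}) = (U - {y}) \<inter> closure C" using clC closure_subset by blast
      then show ?thesis by (auto simp: closedin_closed)
    qed
    ultimately have "C \<inter> (U - {y}) = U - {y}"
      using K(6) zU unfolding U_def[symmetric] connected_clopen by blast
    then have UC: "U - {y} \<subseteq> C" by blast
    have "y islimpt path_image (\<gamma> e)"
    proof (rule connected_imp_perfect)
      show "connected (path_image (\<gamma> e))" using edge(1)[OF e(1)] connected_arc_image by blast
      show "path_image (\<gamma> e) \<noteq> {a}" for a
        using arc_distinct_ends[OF edge(1)[OF e(1)]] pathstart_in_path_image[of "\<gamma> e"] pathfinish_in_path_image[of "\<gamma> e"] by auto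
    qed (rule e(2))
    then obtain q where "q \<in> path_image (\<gamma> e)" "q \<in> T" "q \<noteq> y" using T yU unfolding islimpt_def by blast
    then have "q \<in> C" "q \<in> img E" using UC T edge(2)[OF e(1)] e(1) by (auto simp: img_def)
    then show False using Cp by blast
  qed
  obtain C' where C': "C' \<in> components (S2 - img F)" "C \<subseteq> C'"
    using exists_component_superset[of C "S2 - img F"] Cp FE by blast
  have C'S: "connected C'" "C' \<subseteq> S2 - img F" using C' in_components_connected in_components_subset by blast+
  have opC: "openin (top_of_set S2) C" using openin_component_S2[OF openin_S2_compl[OF closed_img[OF order_refl]] C] .
  then have "openin (top_of_set C') C" using C' C'S by (metis openin_subset_trans Diff_subset order_trans)
  moreover have "closedin (top_of_set C') C"
  proof -
    have "C = C' \<inter> closure C" using key C' C'S(2) closure_subset by blast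
    then show ?thesis by (auto simp: closedin_closed)
  qed
  ultimately have "C = C'" using C'S(1) Cp(2) unfolding connected_clopen by blast
  then show ?thesis using C' by simp
qed

text \<open>With at most two vertices in the closure, all bordering edges share the end set
  \<open>U\<close> and meet only there. Their number decides. With none, \<open>C\<close> is the
  whole sphere. With one, \<open>C\<close> is the full complement of that edge and contains a third
  vertex. With two, \<open>C\<close> is a lens with nothing inside. Three or more contradict
  \<open>theta_component\<close>.\<close>

lemma three_vertices:
  assumes nh: "non_homotopic_drawing V E pos \<gamma>"
    and C: "C \<in> components (S2 - img E)" "closure C \<inter> crossings E = {}"
  shows "3 \<le> card {v \<in> V. pos v \<in> closure C}"
proof (rule ccontr)
  define U where "U = {v \<in> V. pos v \<in> closure C}"
  assume "\<not> ?thesis"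
  then have U: "card U \<le> 2" "finite U" using finite_VE by (auto simp: U_def)
  define F where "F = {e \<in> E. \<exists>x \<in> path_image (\<gamma> e) - pos ` V. x \<in> closure C}"
  have FE: "F \<subseteq> E" by (auto simp: F_def)
  have Fcl: "path_image (\<gamma> e) \<subseteq> closure C" if "e \<in> F" for e
    using edge_in_closure[OF C] that by (auto simp: F_def)
  have FU: "ends e = U" if e: "e \<in> F" for e
  proof (rule card_seteq[OF U(2)])
    have eE: "e \<in> E" using e FE by blast
    show "ends e \<subseteq> U" using Fcl[OF e] edge(4)[OF eE] ends(1)[OF eE] by (auto simp: U_def)
    show "card U \<le> card (ends e)" using U ends(2)[OF eE] by simp
  qed
  have CF: "C \<in> components (S2 - img F)"
    by (rule component_of_boundary_edges[OF C(1) FE]) (auto simp: F_def)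
  have Cp: "connected C" "C \<noteq> {}" "C \<subseteq> S2 - img E"
    using C in_components_connected in_components_nonempty in_components_subset by blast+
  have posE: "pos v \<in> img E" if "v \<in> V" for v using exists_edge[OF that] pos_in_edge_iff[OF _ that] by (auto simp: img_def)
  have Fint: "path_image (\<gamma> e) \<inter> path_image (\<gamma> f) = pos ` U" if ef: "e \<in> F" "f \<in> F" "e \<noteq> f" for e f
  proof
    have eE: "e \<in> E" "f \<in> E" using ef FE by blast+
    show "pos ` U \<subseteq> path_image (\<gamma> e) \<inter> path_image (\<gamma> f)" 
      using edge(4)[OF eE(1)] edge(4)[OF eE(2)] FU[OF ef(1)] FU[OF ef(2)] by blast
    show "path_image (\<gamma> e) \<inter> path_image (\<gamma> f) \<subseteq> pos ` U"
    proof
      fix x assume x: "x \<in> path_image (\<gamma> e) \<inter> path_image (\<gamma> f)"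
      then have "x \<in> pos ` V" using C(2) Fcl[OF ef(1)] eE ef(3) by (auto simp: crossings_def is_crossing_def)
      then show "x \<in> pos ` U" using edge(4)[OF eE(1)] FU[OF ef(1)] x by blast
    qed
  qed
  have Fends: "{pathstart (\<gamma> e), pathfinish (\<gamma> e)} = pos ` U" if "e \<in> F" for e
    using edge(3) FE FU[OF that] that by blast
  have F0: "F \<noteq> {}"
  proof
    assume "F = {}"
    then have "C \<in> components S2" using CF by (simp add: img_def)
    moreover have "connected S2" by (intro connected_sphere) simp
    ultimately have "C = S2" using connected_eq_components_subset_sing by blast
    then show False using Cp(3) img_S2[OF order_refl] E_nonempty edge(1) pathstart_in_path_image by (fastforce simp: img_def)
  qed
  then obtain e1 where e1: "e1 \<in> F" by blast
  have "F \<noteq> {e1}"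
  proof
    assume F1: "F = {e1}"
    have e1E: "e1 \<in> E" using e1 FE by blast
    have "connected (S2 - img F)" using connected_arc_complement_S2 edge(1,2)[OF e1E] F1 by (simp add: img_def)
    then have CS: "C = S2 - img F" using CF connected_eq_components_subset_sing by blast
    have "\<not> V \<subseteq> U" using U V3 card_mono[OF U(2), of V] by linarith
    then obtain v where v: "v \<in> V" "v \<notin> ends e1" using FU[OF e1] by blast
    then have "pos v \<notin> img F" using pos_in_edge_iff[OF e1E v(1)] F1 by (simp add: img_def)
    then have "pos v \<in> C" using CS pos_S2 v(1) by blast
    then show False using Cp(3) posE[OF v(1)] by blast
  qed
  then obtain e2 where e2: "e2 \<in> F" "e2 \<noteq> e1" using e1 by blast
  have eE: "e1 \<in> E" "e2 \<in> E" using e1 e2 FE by blast+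
  show False
  proof (cases "F = {e1, e2}")
    case True
    then have imgF: "img F = \<gamma> e1 ` {0..1} \<union> \<gamma> e2 ` {0..1}" by (auto simp: img_def path_image_def)
    have 1: "{\<gamma> e1 0, \<gamma> e1 1} = pos ` U" "{\<gamma> e2 0, \<gamma> e2 1} = pos ` U"
      using Fends[OF e1] Fends[OF e2(1)] by (simp_all add: pathstart_def pathfinish_def)
    have 2: "\<gamma> e1 0 \<noteq> \<gamma> e1 1" using arc_distinct_ends[OF edge(1)[OF eE(1)]] by (simp add: pathstart_def pathfinish_def)
    have 3: "\<gamma> e1 ` {0..1} \<inter> \<gamma> e2 ` {0..1} = pos ` U" using Fint[OF e1 e2(1)] e2(2) by (simp add: path_image_def)
    \<comment> \<open>The lens is bounded by the two entire edges, so both parameter intervals are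
      the unit interval. Neither alternative can hold: \<open>C\<close> misses the drawing and its
      closure has no crossing.\<close>
    have "(\<exists>v\<in>V. pos v \<in> C) \<or> (\<exists>x\<in>C. is_crossing V E pos \<gamma> x)"
      using nh[unfolded non_homotopic_drawing_def, rule_format, of e1 e2 0 1 0 1 C] eE 1 2 3 CF imgF by simp
    then show False
    proof
      assume "\<exists>v\<in>V. pos v \<in> C"
      then show False using posE Cp(3) by blast
    next
      assume "\<exists>x\<in>C. is_crossing V E pos \<gamma> x"
      then obtain x where "x \<in> C" "x \<in> crossings E" by (auto simp: crossings_def)
      then show False using C(2) closure_subset by blast
    qed
  next
    case False
    then obtain e3 where e3: "e3 \<in> F" "e3 \<noteq> e1" "e3 \<noteq> e2" using e1 e2 by blast
    have e3E: "e3 \<in> E" using e3 FE by blast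
    show False
    proof (rule theta_component[of "\<gamma> e1" "\<gamma> e2" "\<gamma> e3" "pos ` U" C])
      show "C \<subseteq> S2 - (path_image (\<gamma> e1) \<union> path_image (\<gamma> e2) \<union> path_image (\<gamma> e3))"
        using Cp(3) eE e3E by (auto simp: img_def)
    qed (use eE e3E e1 e2 e3 edge(1,2) Fends Fint Fcl Cp in auto)
  qed
qed

section \<open>The final count\<close>

lemma edge_bound:
  assumes nh: "non_homotopic_drawing V E pos \<gamma>" and real: "k_real_face_drawing 2 V E pos \<gamma>"
  shows "card E \<le> 4 * card V - 8"
proof -
  define \<C> where "\<C> = components (S2 - img E)"
  have two: "at_least_k_incidences 2 V pos C" if "C \<in> \<C>" for C
    using real that unfolding k_real_face_drawing_def cells_def drawing_image_eq \<C>_def by blast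
  have inc: "(\<Sum>C\<in>\<F>. max 2 (card {v \<in> V. pos v \<in> closure C})) \<le> 2 * card E" if "finite \<F>" "\<F> \<subseteq> \<C>" for \<F>
    using vertex_incidences[OF that(1)] that two unfolding \<C>_def by blast
  have small: "card \<F> \<le> card E" if F: "finite \<F>" "\<F> \<subseteq> \<C>" for \<F>
  proof -
    have "(\<Sum>C\<in>\<F>. 2) \<le> (\<Sum>C\<in>\<F>. max 2 (card {v \<in> V. pos v \<in> closure C}))" by (intro sum_mono) simp
    then show ?thesis using inc[OF F] by simp
  qed
  \<comment> \<open>The bound for finite families excludes \<open>card E + 1\<close> cells. This
    finiteness is what \<open>many_cells\<close> requires.\<close>
  have fin: "finite \<C>"
  proof (rule ccontr)
    assume "infinite \<C>"
    then obtain \<F> where "finite \<F>" "card \<F> = card E + 1" "\<F> \<subseteq> \<C>" using infinite_arbitrarily_large by blast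
    then show False using small[of \<F>] by simp
  qed
  then have le: "card \<C> \<le> card E" using small by simp
  define \<X> where "\<X> = {C \<in> \<C>. closure C \<inter> crossings E \<noteq> {}}"
  have X: "card \<X> \<le> 4 * card (crossings E)"
  proof (rule crossing_cells)
    show "finite \<X>" using fin by (simp add: \<X>_def)
    show "\<X> \<subseteq> components (S2 - img E)" by (auto simp: \<X>_def \<C>_def)
  qed (simp add: \<X>_def)
  \<comment> \<open>Every cell has weight at least 3: a cell in \<open>\<X>\<close> by 2 + 1, any
    other by \<open>three_vertices\<close>.\<close>
  have "(\<Sum>C\<in>\<C>. 3) \<le> (\<Sum>C\<in>\<C>. max 2 (card {v \<in> V. pos v \<in> closure C}) + (if C \<in> \<X> then 1 else 0))"
  proof (rule sum_mono)
    fix C assume "C \<in> \<C>"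
    then show "3 \<le> max 2 (card {v \<in> V. pos v \<in> closure C}) + (if C \<in> \<X> then 1 else 0)"
      using three_vertices[OF nh, of C] by (auto simp: \<X>_def \<C>_def)
  qed
  also have "\<dots> = (\<Sum>C\<in>\<C>. max 2 (card {v \<in> V. pos v \<in> closure C})) + card (\<C> \<inter> \<X>)"
    using fin by (simp add: sum.distrib sum.If_cases)
  also have "\<C> \<inter> \<X> = \<X>" by (auto simp: \<X>_def)
  finally have "3 * card \<C> \<le> 2 * card E + 4 * card (crossings E)" using inc[OF fin order_refl] X by simp
  moreover have "card E + card (crossings E) + 2 \<le> card \<C> + card V"
    using many_cells fin unfolding \<C>_def by blast
  ultimately show ?thesis using le by simp
qed

end

theorem theorem28:
  fixes V :: "'v set" and E :: "'e set" and ends :: "'e \<Rightarrow> 'v set" and n :: nat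
  assumes "multigraph V E ends"
    and "graph_connected V E ends"
    and "card V = n"
    and "n \<ge> 3"
    and "non_homotopic_k_real_face_graph 2 V E ends"
  shows "card E \<le> 4 * n - 8"
proof -
  obtain pos \<gamma> where d: "drawing V E ends pos \<gamma>" "non_homotopic_drawing V E pos \<gamma>" "k_real_face_drawing 2 V E pos \<gamma>"
    using assms(5) unfolding non_homotopic_k_real_face_graph_def by blast
  interpret sphere_drawing V E ends pos \<gamma>
    using assms d(1) by unfold_locales auto
  show ?thesis using edge_bound[OF d(2,3)] assms(3) by simp
qed

end
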